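(* Let $n\in\mathbb{N}_0$, $q\in\mathbb{C}$ with $q\ne0$, $|q|\ne1$, $a_1,a_2,a_3,a_4\in\mathbb{C}\setminus\{0\}$, $x=\cos\theta$, and let $p,r,t,u$ be the four distinct elements of $\{1,2,3,4\}$ (in any order). Define the Askey–Wilson polynomial \[ p_n(x;\mathbf a|q):=a_p^{-n}\big(\{a_pa_s\}_{s\ne p};q\big)_n\,{}_4\phi_3\!\left(\begin{matrix}q^{-n},q^{n-1}a_{1234},a_p\mathrm e^{i\theta},a_p\mathrm e^{-i\theta}\\ \{a_pa_s\}_{s\neq p}\end{matrix};q,q\right). \] Then (as identities whenever all expressions are defined) this is independent of the choice of $p$, and it equals each of the following: \[ q^{-\binom n2}(-a_p)^{-n}\frac{(\frac{a_{1234}}q;q)_{2n}(a_p\mathrm e^{\pm i\theta};q)_n}{(\frac{a_{1234}}q;q)_n}\,{}_4\phi_3\!\left(\begin{matrix}q^{-n},\{\frac{q^{1-n}}{a_pa_s}\}_{s\ne p}\\ \frac{q^{2-2n}}{a_{1234}},\frac{q^{1-n}\mathrm e^{\pm i\theta}}{a_p}\end{matrix};q,q\right); \] \[ \mathrm e^{in\theta}(a_pa_r,a_t\mathrm e^{-i\theta},a_u\mathrm e^{-i\theta};q)_n\,{}_4\phi_3\!\left(\begin{matrix}q^{-n},a_p\mathrm e^{i\theta},a_r\mathrm e^{i\theta},\frac{q^{1-n}}{a_ta_u}\\ a_pa_r,\frac{q^{1-n}\mathrm e^{i\theta}}{a_t},\frac{q^{1-n}\mathrm e^{i\theta}}{a_u}\end{matrix};q,q\right);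 \] \[ \mathrm e^{in\theta}\frac{(\frac{a_{1234}}q;q)_{2n}(\{a_s\mathrm e^{-i\theta}\}_{s\ne p},\frac{a_{1234}\mathrm e^{-i\theta}}{qa_p};q)_n}{(\frac{a_{1234}}q;q)_n(\frac{a_{1234}\mathrm e^{-i\theta}}{qa_p};q)_{2n}}\,{}_8W_7\!\left(\frac{q^{1-2n}a_p\mathrm e^{i\theta}}{a_{1234}};q^{-n},\{\tfrac{q^{1-n}a_pa_s}{a_{1234}}\}_{s\ne p},a_p\mathrm e^{i\theta};q,\frac{q\mathrm e^{i\theta}}{a_p}\right); \] \[ \mathrm e^{in\theta}\frac{(a_p\mathrm e^{-i\theta},\{\frac{a_{1234}}{a_pa_s}\}_{s\ne p};q)_n}{(\frac{a_{1234}\mathrm e^{i\theta}}{a_p};q)_n}\,{}_8W_7\!\left(\frac{a_{1234}\mathrm e^{i\theta}}{qa_p};q^{-n},\{a_s\mathrm e^{i\theta}\}_{s\ne p},q^{n-1}a_{1234};q,\frac{q\mathrm e^{-i\theta}}{a_p}\right); \] \[ a_p^{-n}\frac{(a_pa_t,a_pa_u,a_r\mathrm e^{\pm i\theta};q)_n}{(\frac{a_r}{a_p};q)_n}\,{}_8W_7\!\left(\frac{q^{-n}a_p}{a_r};q^{-n},\frac{q^{1-n}}{a_ra_t},\frac{q^{1-n}}{a_ra_u},a_p\mathrm e^{\pm i\theta};q,q^na_ta_u\right); \] \[ \mathrm e^{in\theta}\frac{(\{a_s\mathrm e^{-i\theta}\}_{s\in\{1,2,3,4\}};q)_n}{(\mathrm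 e^{-2i\theta};q)_n}\,{}_8W_7\!\left(q^{-n}\mathrm e^{2i\theta};q^{-n},\{a_s\mathrm e^{i\theta}\}_{s\in\{1,2,3,4\}};q,\frac{q^{2-n}}{a_{1234}}\right). \]
   Context: $(a;q)_n:=\prod_{j=0}^{n-1}(1-aq^j)$; $(a_1,\dots,a_k;q)_n:=\prod_i(a_i;q)_n$. Notation: $a_{pr}=a_pa_r$, $a_{1234}=a_1a_2a_3a_4$; $\pm$ or $\mathrm e^{\pm i\theta}$ inside a parameter list means both signs appear as separate entries; $\{f_s\}_{s\ne p}$ denotes the list of the three entries $f_s$, $s\in\{1,2,3,4\}\setminus\{p\}$. Terminating series: ${}_4\phi_3\!\left(\begin{matrix}q^{-n},a_1,a_2,a_3\\ b_1,b_2,b_3\end{matrix};q,z\right)=\sum_{k=0}^n\frac{(q^{-n},a_1,a_2,a_3;q)_k}{(q,b_1,b_2,b_3;q)_k}z^k$, and ${}_8W_7(b;q^{-n},c,d,e,f;q,z):=\sum_{k=0}^n\frac{(b,q\sqrt b,-q\sqrt b,q^{-n},c,d,e,f;q)_k}{(q,\sqrt b,-\sqrt b,q^{n+1}b,\frac{qb}c,\frac{qb}d,\frac{qb}e,\frac{qb}f;q)_k}z^k$. *)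

theory Defs
  imports Complex_Main
begin

definition qp :: "complex \<Rightarrow> complex \<Rightarrow> nat \<Rightarrow> complex" where
  "qp a q n = (\<Prod>j<n. (1 - a * q ^ j))"

definition phi43 :: "nat \<Rightarrow> complex \<Rightarrow> complex \<Rightarrow> complex \<Rightarrow> complex \<Rightarrow> complex \<Rightarrow> complex
    \<Rightarrow> complex \<Rightarrow> complex \<Rightarrow> complex" where
  "phi43 n a1 a2 a3 b1 b2 b3 q z =
     (\<Sum>k\<le>n. (qp (inverse (q ^ n)) q k * qp a1 q k * qp a2 q k * qp a3 q k)
              / (qp q q k * qp b1 q k * qp b2 q k * qp b3 q k) * z ^ k)"

definition phi43_defined :: "nat \<Rightarrow> complex \<Rightarrow> complex \<Rightarrow> complex \<Rightarrow> complex \<Rightarrow> bool" where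
  "phi43_defined n b1 b2 b3 q =
     (\<forall>k\<le>n. qp q q k * qp b1 q k * qp b2 q k * qp b3 q k \<noteq> 0)"

definition W87 :: "complex \<Rightarrow> nat \<Rightarrow> complex \<Rightarrow> complex \<Rightarrow> complex \<Rightarrow> complex
    \<Rightarrow> complex \<Rightarrow> complex \<Rightarrow> complex" where
  "W87 b n c d e f q z =
     (\<Sum>k\<le>n. (qp b q k * qp (q * csqrt b) q k * qp (- q * csqrt b) q k
               * qp (inverse (q ^ n)) q k * qp c q k * qp d q k * qp e q k * qp f q k)
            / (qp q q k * qp (csqrt b) q k * qp (- csqrt b) q k * qp (q ^ (n + 1) * b) q k
               * qp (q * b / c) q k * qp (q * b / d) q k * qp (q * b / e) q k * qp (q * b / f) q k)
            * z ^ k)"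

definition W87_defined :: "complex \<Rightarrow> nat \<Rightarrow> complex \<Rightarrow> complex \<Rightarrow> complex \<Rightarrow> complex
    \<Rightarrow> complex \<Rightarrow> bool" where
  "W87_defined b n c d e f q =
     (c \<noteq> 0 \<and> d \<noteq> 0 \<and> e \<noteq> 0 \<and> f \<noteq> 0 \<and>
      (\<forall>k\<le>n. qp q q k * qp (csqrt b) q k * qp (- csqrt b) q k * qp (q ^ (n + 1) * b) q k
               * qp (q * b / c) q k * qp (q * b / d) q k * qp (q * b / e) q k * qp (q * b / f) q k \<noteq> 0))"

(* Throughout: a :: nat => complex gives a_1..a_4, (p,r,t,u) lists the indices 1..4,
   A = a_1 a_2 a_3 a_4, th = theta (x = cos theta). *)

definition A4 :: "(nat \<Rightarrow> complex) \<Rightarrow> complex" where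
  "A4 a = a 1 * a 2 * a 3 * a 4"

definition AW :: "nat \<Rightarrow> (nat \<Rightarrow> complex) \<Rightarrow> complex \<Rightarrow> complex \<Rightarrow> nat \<Rightarrow> nat \<Rightarrow> nat \<Rightarrow> nat \<Rightarrow> complex" where
  "AW n a q th p r t u =
     inverse (a p ^ n) * qp (a p * a r) q n * qp (a p * a t) q n * qp (a p * a u) q n
     * phi43 n (q powi (int n - 1) * A4 a) (a p * exp (\<i> * th)) (a p * exp (- (\<i> * th)))
               (a p * a r) (a p * a t) (a p * a u) q q"

definition AW_defined :: "nat \<Rightarrow> (nat \<Rightarrow> complex) \<Rightarrow> complex \<Rightarrow> complex \<Rightarrow> nat \<Rightarrow> nat \<Rightarrow> nat \<Rightarrow> nat \<Rightarrow> bool" where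
  "AW_defined n a q th p r t u = phi43_defined n (a p * a r) (a p * a t) (a p * a u) q"

definition rep1 :: "nat \<Rightarrow> (nat \<Rightarrow> complex) \<Rightarrow> complex \<Rightarrow> complex \<Rightarrow> nat \<Rightarrow> nat \<Rightarrow> nat \<Rightarrow> nat \<Rightarrow> complex" where
  "rep1 n a q th p r t u =
     inverse (q ^ (n choose 2)) * inverse ((- a p) ^ n)
     * (qp (A4 a / q) q (2 * n) * qp (a p * exp (\<i> * th)) q n * qp (a p * exp (- (\<i> * th))) q n)
       / qp (A4 a / q) q n
     * phi43 n (q powi (1 - int n) / (a p * a r)) (q powi (1 - int n) / (a p * a t))
               (q powi (1 - int n) / (a p * a u))
               (q powi (2 - 2 * int n) / A4 a) (q powi (1 - int n) * exp (\<i> * th) / a p)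
               (q powi (1 - int n) * exp (- (\<i> * th)) / a p) q q"

definition rep1_defined :: "nat \<Rightarrow> (nat \<Rightarrow> complex) \<Rightarrow> complex \<Rightarrow> complex \<Rightarrow> nat \<Rightarrow> nat \<Rightarrow> nat \<Rightarrow> nat \<Rightarrow> bool" where
  "rep1_defined n a q th p r t u =
     (qp (A4 a / q) q n \<noteq> 0 \<and>
      phi43_defined n (q powi (2 - 2 * int n) / A4 a) (q powi (1 - int n) * exp (\<i> * th) / a p)
               (q powi (1 - int n) * exp (- (\<i> * th)) / a p) q)"

definition rep2 :: "nat \<Rightarrow> (nat \<Rightarrow> complex) \<Rightarrow> complex \<Rightarrow> complex \<Rightarrow> nat \<Rightarrow> nat \<Rightarrow> nat \<Rightarrow> nat \<Rightarrow> complex" where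
  "rep2 n a q th p r t u =
     exp (\<i> * of_nat n * th)
     * qp (a p * a r) q n * qp (a t * exp (- (\<i> * th))) q n * qp (a u * exp (- (\<i> * th))) q n
     * phi43 n (a p * exp (\<i> * th)) (a r * exp (\<i> * th)) (q powi (1 - int n) / (a t * a u))
               (a p * a r) (q powi (1 - int n) * exp (\<i> * th) / a t)
               (q powi (1 - int n) * exp (\<i> * th) / a u) q q"

definition rep2_defined :: "nat \<Rightarrow> (nat \<Rightarrow> complex) \<Rightarrow> complex \<Rightarrow> complex \<Rightarrow> nat \<Rightarrow> nat \<Rightarrow> nat \<Rightarrow> nat \<Rightarrow> bool" where
  "rep2_defined n a q th p r t u =
     phi43_defined n (a p * a r) (q powi (1 - int n) * exp (\<i> * th) / a t)
               (q powi (1 - int n) * exp (\<i> * th) / a u) q"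

definition rep3 :: "nat \<Rightarrow> (nat \<Rightarrow> complex) \<Rightarrow> complex \<Rightarrow> complex \<Rightarrow> nat \<Rightarrow> nat \<Rightarrow> nat \<Rightarrow> nat \<Rightarrow> complex" where
  "rep3 n a q th p r t u =
     exp (\<i> * of_nat n * th)
     * (qp (A4 a / q) q (2 * n) * qp (a r * exp (- (\<i> * th))) q n * qp (a t * exp (- (\<i> * th))) q n
        * qp (a u * exp (- (\<i> * th))) q n * qp (A4 a * exp (- (\<i> * th)) / (q * a p)) q n)
       / (qp (A4 a / q) q n * qp (A4 a * exp (- (\<i> * th)) / (q * a p)) q (2 * n))
     * W87 (q powi (1 - 2 * int n) * a p * exp (\<i> * th) / A4 a) n
           (q powi (1 - int n) * a p * a r / A4 a) (q powi (1 - int n) * a p * a t / A4 a)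
           (q powi (1 - int n) * a p * a u / A4 a) (a p * exp (\<i> * th)) q (q * exp (\<i> * th) / a p)"

definition rep3_defined :: "nat \<Rightarrow> (nat \<Rightarrow> complex) \<Rightarrow> complex \<Rightarrow> complex \<Rightarrow> nat \<Rightarrow> nat \<Rightarrow> nat \<Rightarrow> nat \<Rightarrow> bool" where
  "rep3_defined n a q th p r t u =
     (qp (A4 a / q) q n * qp (A4 a * exp (- (\<i> * th)) / (q * a p)) q (2 * n) \<noteq> 0 \<and>
      W87_defined (q powi (1 - 2 * int n) * a p * exp (\<i> * th) / A4 a) n
           (q powi (1 - int n) * a p * a r / A4 a) (q powi (1 - int n) * a p * a t / A4 a)
           (q powi (1 - int n) * a p * a u / A4 a) (a p * exp (\<i> * th)) q)"

definition rep4 :: "nat \<Rightarrow> (nat \<Rightarrow> complex) \<Rightarrow> complex \<Rightarrow> complex \<Rightarrow> nat \<Rightarrow> nat \<Rightarrow> nat \<Rightarrow> nat \<Rightarrow> complex" where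
  "rep4 n a q th p r t u =
     exp (\<i> * of_nat n * th)
     * (qp (a p * exp (- (\<i> * th))) q n * qp (A4 a / (a p * a r)) q n * qp (A4 a / (a p * a t)) q n
        * qp (A4 a / (a p * a u)) q n)
       / qp (A4 a * exp (\<i> * th) / a p) q n
     * W87 (A4 a * exp (\<i> * th) / (q * a p)) n
           (a r * exp (\<i> * th)) (a t * exp (\<i> * th)) (a u * exp (\<i> * th))
           (q powi (int n - 1) * A4 a) q (q * exp (- (\<i> * th)) / a p)"

definition rep4_defined :: "nat \<Rightarrow> (nat \<Rightarrow> complex) \<Rightarrow> complex \<Rightarrow> complex \<Rightarrow> nat \<Rightarrow> nat \<Rightarrow> nat \<Rightarrow> nat \<Rightarrow> bool" where
  "rep4_defined n a q th p r t u =
     (qp (A4 a * exp (\<i> * th) / a p) q n \<noteq> 0 \<and>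
      W87_defined (A4 a * exp (\<i> * th) / (q * a p)) n
           (a r * exp (\<i> * th)) (a t * exp (\<i> * th)) (a u * exp (\<i> * th))
           (q powi (int n - 1) * A4 a) q)"

definition rep5 :: "nat \<Rightarrow> (nat \<Rightarrow> complex) \<Rightarrow> complex \<Rightarrow> complex \<Rightarrow> nat \<Rightarrow> nat \<Rightarrow> nat \<Rightarrow> nat \<Rightarrow> complex" where
  "rep5 n a q th p r t u =
     inverse (a p ^ n)
     * (qp (a p * a t) q n * qp (a p * a u) q n * qp (a r * exp (\<i> * th)) q n
        * qp (a r * exp (- (\<i> * th))) q n)
       / qp (a r / a p) q n
     * W87 (inverse (q ^ n) * a p / a r) n
           (q powi (1 - int n) / (a r * a t)) (q powi (1 - int n) / (a r * a u))
           (a p * exp (\<i> * th)) (a p * exp (- (\<i> * th))) q (q ^ n * a t * a u)"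

definition rep5_defined :: "nat \<Rightarrow> (nat \<Rightarrow> complex) \<Rightarrow> complex \<Rightarrow> complex \<Rightarrow> nat \<Rightarrow> nat \<Rightarrow> nat \<Rightarrow> nat \<Rightarrow> bool" where
  "rep5_defined n a q th p r t u =
     (qp (a r / a p) q n \<noteq> 0 \<and>
      W87_defined (inverse (q ^ n) * a p / a r) n
           (q powi (1 - int n) / (a r * a t)) (q powi (1 - int n) / (a r * a u))
           (a p * exp (\<i> * th)) (a p * exp (- (\<i> * th))) q)"

definition rep6 :: "nat \<Rightarrow> (nat \<Rightarrow> complex) \<Rightarrow> complex \<Rightarrow> complex \<Rightarrow> complex" where
  "rep6 n a q th =
     exp (\<i> * of_nat n * th)
     * (qp (a 1 * exp (- (\<i> * th))) q n * qp (a 2 * exp (- (\<i> * th))) q n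
        * qp (a 3 * exp (- (\<i> * th))) q n * qp (a 4 * exp (- (\<i> * th))) q n)
       / qp (exp (- (2 * \<i> * th))) q n
     * W87 (inverse (q ^ n) * exp (2 * \<i> * th)) n
           (a 1 * exp (\<i> * th)) (a 2 * exp (\<i> * th)) (a 3 * exp (\<i> * th)) (a 4 * exp (\<i> * th))
           q (q powi (2 - int n) / A4 a)"

definition rep6_defined :: "nat \<Rightarrow> (nat \<Rightarrow> complex) \<Rightarrow> complex \<Rightarrow> complex \<Rightarrow> bool" where
  "rep6_defined n a q th =
     (qp (exp (- (2 * \<i> * th))) q n \<noteq> 0 \<and>
      W87_defined (inverse (q ^ n) * exp (2 * \<i> * th)) n
           (a 1 * exp (\<i> * th)) (a 2 * exp (\<i> * th)) (a 3 * exp (\<i> * th)) (a 4 * exp (\<i> * th)) q)"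

end

theory Submission
  imports Defs
begin

text \<open>
  Everything is a consequence of Watson's transformation of a terminating very-well-poised
  \<open>\<^sub>8W\<^sub>7\<close> into a balanced \<open>\<^sub>4\<phi>\<^sub>3\<close>. The \<open>\<^sub>8W\<^sub>7\<close> is symmetric in its four free parameters
  while the \<open>\<^sub>4\<phi>\<^sub>3\<close> singles out a pair of them, so reading one \<open>\<^sub>8W\<^sub>7\<close> with different pairings
  identifies several \<open>\<^sub>4\<phi>\<^sub>3\<close> series. The fifth representation thus links the defining series to
  the second one, the sixth links all instances of the second one to each other, and the fourth links
  these to the defining series based at the other three parameters; the third is one more instance of
  the second. The first representation is the defining series summed in reverse order.
  Multiplying each \<open>\<^sub>4\<phi>\<^sub>3\<close> by its lower \<open>q\<close>-shifted factorials makes the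
  intermediate series meaningful for all parameter values, so no genericity argument is needed.

  Watson's transformation itself follows by expanding part of the summand with the
  \<open>q\<close>-Pfaff--Saalschuetz sum, interchanging summations, and evaluating the inner sum, a
  terminating \<open>\<^sub>6\<phi>\<^sub>5\<close>. The same expansion reduces that sum to the telescoping sum
  \<open>very_well_poised_telescope\<close>.
\<close>

section \<open>Shifted factorials\<close>

lemma qp_0 [simp]: "qp a q 0 = 1"
  by (simp add: qp_def)

lemma qp_Suc: "qp a q (Suc n) = qp a q n * (1 - a * q ^ n)"
  by (simp add: qp_def)

lemma qp_add: "qp a q (m + n) = qp a q m * qp (a * q ^ m) q n"
  by (induction n) (simp_all add: qp_Suc power_add mult_ac)

lemma qp_Suc_left: "qp a q (Suc n) = (1 - a) * qp (a * q) q n"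
  using qp_add[of a q 1 n] by (simp add: qp_Suc)

lemma qp_split: "k \<le> n \<Longrightarrow> qp a q n = qp a q k * qp (a * q ^ k) q (n - k)"
  using qp_add[of a q k "n - k"] by simp

lemma qp_nonzero_le: "qp a q n \<noteq> 0 \<Longrightarrow> k \<le> n \<Longrightarrow> qp a q k \<noteq> 0"
  using qp_split[of k n a q] by auto

text \<open>The factor with index k is zero; this terminates every series carrying q^(-k).\<close>

lemma qp_inverse_power_eq_0:
  assumes "q \<noteq> 0" "k < m"
  shows "qp (inverse (q ^ k)) q m = 0"
  using assms by (auto simp: qp_def intro!: bexI[of _ k])

lemma qp_q_q_nonzero:
  assumes "norm q \<noteq> 1"
  shows "qp q q n \<noteq> 0"
proof -
  have "q * q ^ j \<noteq> 1" for j
  proof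
    assume "q * q ^ j = 1"
    then have "norm q ^ Suc j = 1"
      by (metis norm_one norm_power power_Suc)
    with assms show False
      using power_eq_iff_eq_base[of "Suc j" "norm q" 1] by simp
  qed
  then show ?thesis by (auto simp: qp_def)
qed

lemma one_minus_power_nonzero:
  assumes "norm (q::complex) \<noteq> 1"
  shows "1 - q * q ^ n \<noteq> 0"
  using qp_q_q_nonzero[OF assms, of "Suc n"] by (simp add: qp_Suc)

section \<open>Exponents of q and reversal of shifted factorials\<close>

lemma choose_two_Suc: "Suc n choose 2 = (n choose 2) + n"
  by (simp add: numeral_2_eq_2)

lemma choose_two_add: "(m + n) choose 2 = (m choose 2) + (n choose 2) + m * n"
  by (induction n) (simp_all add: choose_two_Suc)

lemma choose_two_double: "2 * (n choose 2) + n = n * n"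
  by (induction n) (simp_all add: choose_two_Suc)

text \<open>Factor by factor, 1 - a q^j = -a q^j (1 - q^(-j)/a); read from the last factor down, the
  new factors start at q^(1-n)/a. The induction peels off the first factor 1 - a, which becomes the
  last factor on the right.\<close>

lemma qp_reverse:
  assumes "a \<noteq> 0" "q \<noteq> 0"
  shows "qp a q n = (- a) ^ n * q ^ (n choose 2) * qp (q / (q ^ n * a)) q n"
  using assms(1)
proof (induction n arbitrary: a)
  case (Suc n)
  have arg: "q / (q ^ n * (a * q)) = q / (q ^ Suc n * a)"
    by (simp add: mult_ac)
  have last: "q / (q ^ Suc n * a) * q ^ n = 1 / a"
    using Suc.prems assms(2) by (simp add: field_simps)
  have "qp a q (Suc n) = (1 - a) * ((- (a * q)) ^ n * q ^ (n choose 2) * qp (q / (q ^ Suc n * a)) q n)"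
    unfolding qp_Suc_left using Suc.IH[of "a * q"] Suc.prems assms(2) arg by simp
  also have "\<dots> = (- a) ^ Suc n * q ^ (Suc n choose 2) * qp (q / (q ^ Suc n * a)) q (Suc n)"
  proof -
    have *: "(- (a * q)) ^ n = (- a) ^ n * q ^ n"
      by (metis mult_minus_left power_mult_distrib)
    have **: "1 - a = - a * (1 - 1 / a)"
      using Suc.prems by (simp add: field_simps)
    show ?thesis
      unfolding qp_Suc last choose_two_Suc power_add * by (subst **) simp
  qed
  finally show ?case .
qed (simp add: numeral_2_eq_2)

text \<open>This is the reversal of (q^(m+1);q)_j, the quotient of (q;q)_(j+m) by (q;q)_m, cleared
  of denominators.\<close>

lemma qp_inverse_power:
  assumes "q \<noteq> 0"
  shows "qp (inverse (q ^ (j + m))) q j * ((- q) ^ j * q ^ (m * j) * q ^ (j choose 2)) * qp q q m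
    = qp q q (j + m)"
proof -
  have arg: "q / (q ^ j * (q * q ^ m)) = inverse (q ^ (j + m))"
    using assms by (simp add: field_simps power_add)
  have pw: "(- (q * q ^ m)) ^ j = (- q) ^ j * q ^ (m * j)"
    by (metis mult_minus_left power_mult power_mult_distrib)
  have "qp (q * q ^ m) q j
      = (- q) ^ j * q ^ (m * j) * q ^ (j choose 2) * qp (inverse (q ^ (j + m))) q j"
    using qp_reverse[of "q * q ^ m" q j] assms unfolding arg pw by simp
  then show ?thesis
    using qp_add[of q q m j] by (simp add: add.commute mult_ac)
qed

section \<open>Summation formulas\<close>

text \<open>Creative telescoping: \<open>F k\<close> is the summand of the q-Saalschuetz sum, with X
  d = qb/c and X c = qb/d. The partial sums over j carry the factor (q^(-k);q)_J, so that the sum up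
  to J = k + 1 vanishes and gives a first-order recurrence in k.\<close>

lemma q_saalschuetz_telescope:
  fixes q b c d X :: complex
  assumes q: "q \<noteq> 0" "norm q \<noteq> 1" and b: "q * b = X * c * d"
    and nz: "qp (X * d) q J \<noteq> 0" "qp (X * c) q J \<noteq> 0"
  defines "F \<equiv> \<lambda>k j. qp (inverse (q ^ k)) q j * qp (b * q ^ k) q j * qp X q j
      / (qp q q j * qp (X * d) q j * qp (X * c) q j) * q ^ j"
  shows "(\<Sum>j\<le>J. (1 - X * d * q ^ k) * (1 - X * c * q ^ k) * F (Suc k) j
        - X * (1 - c * q ^ k) * (1 - d * q ^ k) * F k j)
    = (1 - q * b * q ^ k * q ^ k) * qp (inverse (q ^ k)) q J * qp (b * q ^ Suc k) q J
      * qp X q (Suc J) / (qp q q J * qp (X * d) q J * qp (X * c) q J)"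
  using nz
proof (induction J)
  case 0
  show ?case unfolding F_def
    by (simp add: qp_Suc b) (simp add: algebra_simps)
next
  case (Suc J)
  define x where "x = q ^ J"
  define y where "y = q ^ k"
  have y: "y \<noteq> 0" using q by (simp add: y_def)
  have nz: "qp (X * d) q J \<noteq> 0" "1 - X * d * x \<noteq> 0" "qp (X * c) q J \<noteq> 0" "1 - X * c * x \<noteq> 0"
    using Suc.prems by (auto simp: qp_Suc x_def)
  have nq: "qp q q J \<noteq> 0" "1 - q * x \<noteq> 0"
    using qp_q_q_nonzero[OF q(2)] one_minus_power_nonzero[OF q(2)] by (auto simp: x_def)
  define h where "h = qp (inverse y) q J * qp (b * (q * y)) q J * qp X q (Suc J)
      / (qp q q J * qp (X * d) q J * qp (X * c) q J)"
  define D where "D = (1 - q * x) * (1 - X * d * x) * (1 - X * c * x)"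
  have D: "D \<noteq> 0" using nz nq by (simp add: D_def)
  \<comment> \<open>Peeling the first factor off (q^(-k-1);q)_(J+1) here, and off (b q^k;q)_(J+1)
    next, leaves both summands with the common part \<open>h\<close>.\<close>
  have e1: "qp (inverse (q ^ Suc k)) q (Suc J) = (1 - inverse (q * y)) * qp (inverse y) q J"
    unfolding qp_Suc_left using q by (simp add: y_def field_simps)
  have e2: "qp (b * q ^ k) q (Suc J) = (1 - b * y) * qp (b * (q * y)) q J"
    unfolding qp_Suc_left by (simp add: y_def mult_ac)
  have F1: "F (Suc k) (Suc J) = h / D * (q * x) * ((1 - inverse (q * y)) * (1 - b * (q * y) * x))"
    unfolding F_def e1 by (simp add: qp_Suc h_def D_def x_def y_def mult_ac)
  have F0: "F k (Suc J) = h / D * (q * x) * ((1 - inverse y * x) * (1 - b * y))"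
    unfolding F_def e2 by (simp add: qp_Suc h_def D_def x_def y_def mult_ac)
  have G1: "qp (inverse (q ^ k)) q (Suc J) * qp (b * q ^ Suc k) q (Suc J) * qp X q (Suc (Suc J))
      / (qp q q (Suc J) * qp (X * d) q (Suc J) * qp (X * c) q (Suc J))
      = h / D * ((1 - inverse y * x) * (1 - b * (q * y) * x) * (1 - X * (q * x)))"
    by (simp add: qp_Suc h_def D_def x_def y_def mult_ac)
  have G0: "qp (inverse (q ^ k)) q J * qp (b * q ^ Suc k) q J * qp X q (Suc J)
      / (qp q q J * qp (X * d) q J * qp (X * c) q J) = h / D * D"
    using D by (simp add: h_def y_def)
  have b': "b = X * c * d / q" using b q by (simp add: field_simps)
  \<comment> \<open>The induction step divided by \<open>h / D\<close>: an identity of rational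
    functions in x = q^J and y = q^k.\<close>
  have key: "(1 - q * b * y * y) * D + (q * x) *
       ((1 - X * d * y) * (1 - X * c * y) * ((1 - inverse (q * y)) * (1 - b * (q * y) * x))
        - X * (1 - c * y) * (1 - d * y) * ((1 - inverse y * x) * (1 - b * y)))
     = (1 - q * b * y * y) * ((1 - inverse y * x) * (1 - b * (q * y) * x) * (1 - X * (q * x)))"
    unfolding D_def b' using q(1) y by (simp add: divide_simps) algebra
  show ?case
  proof -
    have "(1 - q * b * y * y) * (h / D * D) + ((1 - X * d * y) * (1 - X * c * y)
         * (h / D * (q * x) * ((1 - inverse (q * y)) * (1 - b * (q * y) * x)))
        - X * (1 - c * y) * (1 - d * y) * (h / D * (q * x) * ((1 - inverse y * x) * (1 - b * y))))
      = (1 - q * b * y * y) * (h / D * ((1 - inverse y * x) * (1 - b * (q * y) * x) * (1 - X * (q * x))))"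
      (is "?L = ?R")
      using arg_cong[OF key, of "\<lambda>v. h / D * v"] by algebra
    then show ?thesis
      unfolding sum.atMost_Suc Suc.IH[OF nz(1,3)] F0 F1
      using G0 G1 by (simp only: y_def[symmetric] mult.assoc times_divide_eq_right[symmetric])
  qed
qed

text \<open>Induction on k: telescoping up to k + 1 leaves zero, and the product on the right obeys
  the same first-order recurrence. In this parametrization the sum can be read backwards, replacing
  the pair c, d in a very-well-poised summand by a series in j.\<close>

lemma q_saalschuetz:
  fixes q b c d :: complex
  assumes q: "q \<noteq> 0" "norm q \<noteq> 1" and cd: "c \<noteq> 0" "d \<noteq> 0"
    and nz: "qp (q * b / c) q k \<noteq> 0" "qp (q * b / d) q k \<noteq> 0"
  shows "(\<Sum>j\<le>k. qp (inverse (q ^ k)) q j * qp (b * q ^ k) q j * qp (q * b / (c * d)) q j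
      / (qp q q j * qp (q * b / c) q j * qp (q * b / d) q j) * q ^ j)
    = qp c q k * qp d q k / (qp (q * b / c) q k * qp (q * b / d) q k) * (q * b / (c * d)) ^ k"
  using nz
proof (induction k)
  case (Suc k)
  define X where "X = q * b / (c * d)"
  have X: "q * b / c = X * d" "q * b / d = X * c" "q * b = X * c * d"
    using cd by (simp_all add: X_def)
  define F where "F = (\<lambda>k j. qp (inverse (q ^ k)) q j * qp (b * q ^ k) q j * qp X q j
      / (qp q q j * qp (X * d) q j * qp (X * c) q j) * q ^ j)"
  have nz: "qp (X * d) q k \<noteq> 0" "1 - X * d * q ^ k \<noteq> 0" "qp (X * c) q k \<noteq> 0" "1 - X * c * q ^ k \<noteq> 0"
    using Suc.prems unfolding X(1,2) by (auto simp: qp_Suc)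
  have IH: "sum (F k) {..k} = qp c q k * qp d q k / (qp (X * d) q k * qp (X * c) q k) * X ^ k"
    using Suc.IH nz unfolding X_def[symmetric] X(1,2) F_def by blast
  have "(\<Sum>j\<le>Suc k. (1 - X * d * q ^ k) * (1 - X * c * q ^ k) * F (Suc k) j
        - X * (1 - c * q ^ k) * (1 - d * q ^ k) * F k j) = 0"
    unfolding F_def
    using Suc.prems unfolding X(1,2)
    by (subst q_saalschuetz_telescope[OF q X(3)]) (simp_all add: qp_inverse_power_eq_0 q)
  then have "(1 - X * d * q ^ k) * (1 - X * c * q ^ k) * sum (F (Suc k)) {..Suc k}
      = X * (1 - c * q ^ k) * (1 - d * q ^ k) * sum (F k) {..Suc k}"
    by (simp only: sum_subtractf sum_distrib_left[symmetric] right_minus_eq)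
  \<comment> \<open>The extra term j = k + 1 contains (q^(-k);q)_(k+1) = 0.\<close>
  also have "sum (F k) {..Suc k} = sum (F k) {..k}"
    by (simp add: F_def qp_inverse_power_eq_0 q)
  finally have "sum (F (Suc k)) {..Suc k}
      = X * (1 - c * q ^ k) * (1 - d * q ^ k) * sum (F k) {..k} / ((1 - X * d * q ^ k) * (1 - X * c * q ^ k))"
    using nz by (simp add: eq_divide_eq mult_ac)
  then have "sum (F (Suc k)) {..Suc k}
      = qp c q (Suc k) * qp d q (Suc k) / (qp (X * d) q (Suc k) * qp (X * c) q (Suc k)) * X ^ Suc k"
    unfolding IH by (simp add: qp_Suc mult_ac)
  then show ?case
    unfolding X_def[symmetric] X(1,2) F_def .
qed simp

text \<open>An indefinite sum: the closed form holds for every upper bound M, since adding one more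
  term amounts to the identity \<open>key\<close>. The very-well-poised factor (1 - b q^(2m)) / (1 -
  b) appears without its denominator, so b = 1 causes no trouble.\<close>

lemma very_well_poised_telescope:
  fixes q b y :: complex
  assumes q: "q \<noteq> 0" "norm q \<noteq> 1" and y: "y \<noteq> 0" and nz: "qp (q * y * b) q M \<noteq> 0"
  shows "(\<Sum>m\<le>M. (1 - b * q ^ (2 * m)) * qp b q m / qp q q m
        * (qp (inverse y) q m / qp (q * y * b) q m * y ^ m))
    = qp b q (Suc M) * qp (q / y) q M / (qp q q M * qp (q * y * b) q M) * y ^ M"
  using nz
proof (induction M)
  case 0
  show ?case by (simp add: qp_Suc)
next
  case (Suc M)
  define x where "x = q * q ^ M"
  have nz: "qp (q * y * b) q M \<noteq> 0" "1 - y * b * x \<noteq> 0"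
    using Suc.prems by (auto simp: qp_Suc x_def mult_ac)
  have nq: "qp q q M \<noteq> 0" "1 - x \<noteq> 0"
    using qp_q_q_nonzero[OF q(2)] one_minus_power_nonzero[OF q(2)] by (auto simp: x_def)
  define h where "h = qp b q (Suc M) * qp (q / y) q M / (qp q q M * qp (q * y * b) q M) * y ^ M"
  define D where "D = (1 - x) * (1 - y * b * x)"
  have D: "D \<noteq> 0" using nz nq by (simp add: D_def)
  have e1: "qp (inverse y) q (Suc M) = (1 - inverse y) * qp (q / y) q M"
    unfolding qp_Suc_left by (simp add: divide_inverse mult.commute)
  have e2: "qp (q / y) q (Suc M) = qp (q / y) q M * (1 - x / y)"
    by (simp add: qp_Suc x_def)
  have e3: "qp q q (Suc M) * qp (q * y * b) q (Suc M) = qp q q M * qp (q * y * b) q M * D"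
    by (simp add: qp_Suc x_def D_def mult_ac)
  have e4: "qp b q (Suc (Suc M)) = qp b q (Suc M) * (1 - b * x)"
    by (simp add: qp_Suc x_def)
  have e5: "q ^ (2 * Suc M) = x * x"
    by (simp add: x_def power_mult power2_eq_square power_mult_distrib)
  \<comment> \<open>The induction step divided by \<open>h / D\<close>, where \<open>D\<close>
    collects the two new lower factors.\<close>
  have key: "D + (1 - b * (x * x)) * ((1 - inverse y) * y) = (1 - b * x) * ((1 - x / y) * y)"
    unfolding D_def using y by (simp add: divide_simps) algebra
  have "(1 - b * q ^ (2 * Suc M)) * qp b q (Suc M) / qp q q (Suc M)
        * (qp (inverse y) q (Suc M) / qp (q * y * b) q (Suc M) * y ^ Suc M)
      = h / D * ((1 - b * (x * x)) * ((1 - inverse y) * y))"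
  proof -
    have "?thesis \<longleftrightarrow> (1 - b * q ^ (2 * Suc M)) * qp b q (Suc M) * qp (inverse y) q (Suc M)
        / (qp q q (Suc M) * qp (q * y * b) q (Suc M)) * y ^ Suc M
      = h / D * ((1 - b * (x * x)) * ((1 - inverse y) * y))" by (simp add: mult_ac)
    also have \<dots> unfolding e1 e3 e5 h_def by (simp add: mult_ac)
    finally show ?thesis by blast
  qed
  moreover have "qp b q (Suc (Suc M)) * qp (q / y) q (Suc M)
        / (qp q q (Suc M) * qp (q * y * b) q (Suc M)) * y ^ Suc M
      = h / D * ((1 - b * x) * ((1 - x / y) * y))"
    unfolding e2 e3 e4 h_def by (simp add: mult_ac)
  moreover have "h = h / D * D" using D by simp
  ultimately show ?case
    unfolding sum.atMost_Suc Suc.IH[OF nz(1)] h_def[symmetric]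
    by (metis distrib_left key)
qed

text \<open>With y = q^N the telescoped value carries (q^(1-N);q)_N, which vanishes for N > 0. This
  kills every inner sum but the last one after the interchange in
  \<open>rogers_6phi5_sum\<close>.\<close>

lemma very_well_poised_orthogonality:
  fixes q b :: complex
  assumes q: "q \<noteq> 0" "norm q \<noteq> 1" and nz: "qp (q ^ Suc N * b) q N \<noteq> 0" and N: "N > 0"
  shows "(\<Sum>m\<le>N. (1 - b * q ^ (2 * m)) * qp b q m / qp q q m
        * (qp (inverse (q ^ N)) q m / qp (q ^ Suc N * b) q m * q ^ (N * m))) = 0"
proof -
  obtain N' where N': "N = Suc N'" using N by (cases N) auto
  have "q / q ^ N = inverse (q ^ N')"
    using q by (simp add: N' divide_inverse)
  then have "qp (q / q ^ N) q N = 0"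
    using qp_inverse_power_eq_0[OF q(1), of N' N] by (simp add: N')
  then show ?thesis
    using very_well_poised_telescope[OF q, of "q ^ N" b N] nz q by (simp add: power_mult)
qed

section \<open>Interchange of summations and the terminating 6phi5 sum\<close>

lemma sum_triangle_shift:
  fixes f :: "nat \<Rightarrow> nat \<Rightarrow> 'a::comm_monoid_add"
  shows "(\<Sum>k\<le>n. \<Sum>j\<le>k. f k j) = (\<Sum>j\<le>n. \<Sum>m\<le>n - j. f (j + m) j)"
  unfolding sum.Sigma[OF finite_atMost ballI[OF finite_atMost]]
  by (rule sum.reindex_bij_witness[where i = "\<lambda>(j, m). (j + m, j)" and j = "\<lambda>(k, j). (j, k - j)"])
    auto

text \<open>The inner sum on the right is again very-well-poised, with \<open>b\<close> replaced by
  \<open>b q\<^sup>2\<^sup>j\<close>; this is what makes the interchange useful.\<close>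

lemma very_well_poised_interchange:
  fixes q b :: complex and g \<beta> :: "nat \<Rightarrow> complex"
  assumes q: "q \<noteq> 0" "norm q \<noteq> 1"
  shows "(\<Sum>k\<le>n. (1 - b * q ^ (2 * k)) * qp b q k / qp q q k * g k
        * (\<Sum>j\<le>k. qp (inverse (q ^ k)) q j * qp (b * q ^ k) q j * \<beta> j * q ^ j))
    = (\<Sum>j\<le>n. \<beta> j * qp b q (2 * j) * (- 1) ^ j / q ^ (j choose 2)
        * (\<Sum>m\<le>n - j. (1 - b * q ^ (2 * j) * q ^ (2 * m)) * qp (b * q ^ (2 * j)) q m / qp q q m
            * (g (j + m) / q ^ (m * j))))"
proof -
  have "(1 - b * q ^ (2 * (j + m))) * qp b q (j + m) / qp q q (j + m) * g (j + m)
        * (qp (inverse (q ^ (j + m))) q j * qp (b * q ^ (j + m)) q j * \<beta> j * q ^ j)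
      = \<beta> j * qp b q (2 * j) * (- 1) ^ j / q ^ (j choose 2)
        * ((1 - b * q ^ (2 * j) * q ^ (2 * m)) * qp (b * q ^ (2 * j)) q m / qp q q m
            * (g (j + m) / q ^ (m * j)))" for j m
  proof -
    have nq: "qp q q (j + m) \<noteq> 0" "qp q q m \<noteq> 0"
      using qp_q_q_nonzero[OF q(2)] by auto
    \<comment> \<open>Both sides are (b;q)_(2j+m), split at j + m and at 2j.\<close>
    have e1: "qp b q (j + m) * qp (b * q ^ (j + m)) q j = qp b q (2 * j) * qp (b * q ^ (2 * j)) q m"
      using qp_add[of b q "j + m" j] qp_add[of b q "2 * j" m] by (simp add: mult_2 add_ac)
    have sq: "((- 1) ^ j * (- 1) ^ j :: complex) = 1"
      by (simp flip: power_mult_distrib)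
    \<comment> \<open>\<open>qp_inverse_power\<close> trades (q;q)_(j+m) for (q;q)_m; the leftover
      q^(m j) is the power dividing \<open>g (j + m)\<close>.\<close>
    have e2: "qp (inverse (q ^ (j + m))) q j * q ^ j / qp q q (j + m)
        = (- 1) ^ j / (q ^ (j choose 2) * qp q q m * q ^ (m * j))"
    proof -
      have "qp (inverse (q ^ (j + m))) q j * (((- 1) ^ j * q ^ j) * q ^ (m * j) * q ^ (j choose 2)) * qp q q m
          = qp q q (j + m)" (is "?P = _")
        using qp_inverse_power[OF q(1), of j m] by (simp flip: power_mult_distrib)
      then have "qp q q (j + m) * (- 1) ^ j = ?P * (- 1) ^ j" by simp
      then have "qp q q (j + m) * (- 1) ^ j = ((- 1) ^ j * (- 1) ^ j)
          * (qp (inverse (q ^ (j + m))) q j * q ^ j * (q ^ (m * j) * q ^ (j choose 2) * qp q q m))"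
        by (simp only: mult_ac)
      then show ?thesis
        unfolding sq using nq q by (simp add: divide_simps mult_ac)
    qed
    have "(1 - b * q ^ (2 * (j + m))) * qp b q (j + m) / qp q q (j + m) * g (j + m)
        * (qp (inverse (q ^ (j + m))) q j * qp (b * q ^ (j + m)) q j * \<beta> j * q ^ j)
      = (1 - b * q ^ (2 * (j + m))) * (qp b q (j + m) * qp (b * q ^ (j + m)) q j) * g (j + m) * \<beta> j
        * (qp (inverse (q ^ (j + m))) q j * q ^ j / qp q q (j + m))"
      by (simp add: mult_ac)
    also have "\<dots> = (1 - b * q ^ (2 * (j + m))) * (qp b q (2 * j) * qp (b * q ^ (2 * j)) q m) * g (j + m) * \<beta> j
        * ((- 1) ^ j / (q ^ (j choose 2) * qp q q m * q ^ (m * j)))"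
      unfolding e1 e2 ..
    finally show ?thesis
      by (simp add: mult_ac power_add distrib_left)
  qed
  then show ?thesis
    unfolding sum_distrib_left sum_triangle_shift by (intro sum.cong refl) simp
qed

text \<open>The pair e, f is expanded by \<open>q_saalschuetz\<close>; after the interchange,
  orthogonality leaves only the term j = n. The right side has (b;q)_(n+1) rather than (qb;q)_n
  because 1 - b q^(2k) is not divided by 1 - b.\<close>

lemma rogers_6phi5_sum:
  fixes q b e f :: complex
  assumes q: "q \<noteq> 0" "norm q \<noteq> 1" and ef: "e \<noteq> 0" "f \<noteq> 0"
    and nz: "qp (q ^ Suc n * b) q n \<noteq> 0" "qp (q * b / e) q n \<noteq> 0" "qp (q * b / f) q n \<noteq> 0"
  shows "(\<Sum>k\<le>n. (1 - b * q ^ (2 * k)) * qp b q k / qp q q k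
        * (qp (inverse (q ^ n)) q k * qp e q k * qp f q k
          / (qp (q ^ Suc n * b) q k * qp (q * b / e) q k * qp (q * b / f) q k)
          * (q ^ Suc n * b / (e * f)) ^ k))
    = qp b q (Suc n) * qp (q * b / (e * f)) q n / (qp (q * b / e) q n * qp (q * b / f) q n)"
    (is "?lhs = ?rhs")
proof -
  define X where "X = q * b / (e * f)"
  \<comment> \<open>The argument of the series is q^n X. The power X^k is produced by the
    Saalschuetz sum, so \<open>g\<close> keeps only q^(n k).\<close>
  define g where "g = (\<lambda>k. qp (inverse (q ^ n)) q k / qp (q ^ Suc n * b) q k * q ^ (n * k))"
  define \<beta> where "\<beta> = (\<lambda>j. qp X q j / (qp q q j * qp (q * b / e) q j * qp (q * b / f) q j))"
  define C where "C = (\<lambda>j. \<beta> j * qp b q (2 * j) * (- 1) ^ j / q ^ (j choose 2))"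
  define inner where "inner = (\<lambda>j. \<Sum>m\<le>n - j. (1 - b * q ^ (2 * j) * q ^ (2 * m))
      * qp (b * q ^ (2 * j)) q m / qp q q m * (g (j + m) / q ^ (m * j)))"
  have "?lhs = (\<Sum>k\<le>n. (1 - b * q ^ (2 * k)) * qp b q k / qp q q k * g k
        * (\<Sum>j\<le>k. qp (inverse (q ^ k)) q j * qp (b * q ^ k) q j * \<beta> j * q ^ j))"
  proof (intro sum.cong refl)
    fix k assume "k \<in> {..n}"
    then have k: "k \<le> n" by simp
    have S: "(\<Sum>j\<le>k. qp (inverse (q ^ k)) q j * qp (b * q ^ k) q j * \<beta> j * q ^ j)
        = qp e q k * qp f q k / (qp (q * b / e) q k * qp (q * b / f) q k) * X ^ k"
      using q_saalschuetz[OF q ef qp_nonzero_le[OF nz(2) k] qp_nonzero_le[OF nz(3) k]]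
      unfolding \<beta>_def X_def by simp
    have Z: "(q ^ Suc n * b / (e * f)) ^ k = q ^ (n * k) * X ^ k"
      unfolding X_def by (simp add: power_mult_distrib power_divide mult_ac flip: power_mult)
    show "(1 - b * q ^ (2 * k)) * qp b q k / qp q q k
        * (qp (inverse (q ^ n)) q k * qp e q k * qp f q k
          / (qp (q ^ Suc n * b) q k * qp (q * b / e) q k * qp (q * b / f) q k)
          * (q ^ Suc n * b / (e * f)) ^ k)
      = (1 - b * q ^ (2 * k)) * qp b q k / qp q q k * g k
        * (\<Sum>j\<le>k. qp (inverse (q ^ k)) q j * qp (b * q ^ k) q j * \<beta> j * q ^ j)"
      unfolding S Z g_def by (simp add: mult_ac)
  qed
  also have "\<dots> = (\<Sum>j\<le>n. C j * inner j)"
    unfolding very_well_poised_interchange[OF q] C_def inner_def ..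
  \<comment> \<open>For j < n the inner sum is, up to a factor in j alone, the orthogonality sum of
    length N = n - j with base b q^(2j), hence zero.\<close>
  also have "\<dots> = (\<Sum>j\<in>{n}. C j * inner j)"
  proof (intro sum.mono_neutral_right ballI)
    fix j assume "j \<in> {..n} - {n}"
    then have j: "j < n" by auto
    define N where "N = n - j"
    have n: "n = j + N" using j by (simp add: N_def)
    have g: "g (j + m) / q ^ (m * j) = qp (inverse (q ^ n)) q j / qp (q ^ Suc n * b) q j * q ^ (n * j)
        * (qp (inverse (q ^ N)) q m / qp (q ^ Suc N * (b * q ^ (2 * j))) q m * q ^ (N * m))" for m
    proof -
      have a: "inverse (q ^ n) * q ^ j = inverse (q ^ N)"
        using q by (simp add: n power_add field_simps)
      have b: "q ^ Suc n * b * q ^ j = q ^ Suc N * (b * q ^ (2 * j))"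
        by (simp add: n power_add mult_2 mult_2_right mult_ac)
      have p: "q ^ (n * (j + m)) = q ^ (n * j) * q ^ (N * m) * q ^ (m * j)"
        by (simp add: n algebra_simps power_add)
      show ?thesis
        unfolding g_def qp_add a b p using q by (simp add: mult_ac)
    qed
    have nz': "qp (q ^ Suc N * (b * q ^ (2 * j))) q N \<noteq> 0"
    proof -
      have "qp (q ^ Suc n * b) q n = qp (q ^ Suc n * b) q j * qp (q ^ Suc n * b * q ^ j) q N"
        using qp_add[of "q ^ Suc n * b" q j N] by (simp add: n)
      moreover have "q ^ Suc n * b * q ^ j = q ^ Suc N * (b * q ^ (2 * j))"
        by (simp add: n power_add mult_2 mult_2_right mult_ac)
      ultimately show ?thesis using nz(1) by (metis mult_eq_0_iff)
    qed
    have "inner j = qp (inverse (q ^ n)) q j / qp (q ^ Suc n * b) q j * q ^ (n * j)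
      * (\<Sum>m\<le>N. (1 - b * q ^ (2 * j) * q ^ (2 * m)) * qp (b * q ^ (2 * j)) q m / qp q q m
          * (qp (inverse (q ^ N)) q m / qp (q ^ Suc N * (b * q ^ (2 * j))) q m * q ^ (N * m)))"
      unfolding inner_def N_def[symmetric] g sum_distrib_left
      by (intro sum.cong refl) (simp add: mult_ac)
    also have "\<dots> = 0"
      using very_well_poised_orthogonality[OF q nz'] j by (simp add: N_def)
    finally show "C j * inner j = 0" by simp
  qed auto
  also have "\<dots> = ?rhs"
  proof -
    have nq: "qp q q n \<noteq> 0" using qp_q_q_nonzero[OF q(2)] .
    \<comment> \<open>In the surviving term m = 0. Both sides are (b;q)_(2n+1), and the last factor
      cancels the lower factorial in \<open>g\<close>.\<close>
    have B: "qp b q (2 * n) * (1 - b * q ^ (2 * n)) = qp b q (Suc n) * qp (q ^ Suc n * b) q n"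
    proof -
      have "qp b q (Suc (2 * n)) = qp b q (Suc n) * qp (b * q ^ Suc n) q n"
        using qp_add[of b q "Suc n" n] by (simp add: mult_2)
      then show ?thesis by (simp add: qp_Suc mult_ac)
    qed
    have sq: "((- 1) ^ n * (- 1) ^ n :: complex) = 1"
      by (simp flip: power_mult_distrib)
    have p: "q ^ (n * n) = q ^ (n choose 2) * q ^ (n choose 2) * q ^ n"
      by (simp flip: power_add choose_two_double mult_2)
    have e: "qp (inverse (q ^ n)) q n * q ^ (n * n) = (- 1) ^ n * q ^ (n choose 2) * qp q q n"
    proof -
      have "qp (inverse (q ^ n)) q n * ((- 1) ^ n * q ^ n * q ^ (n choose 2)) = qp q q n" (is "?P = _")
        using qp_inverse_power[OF q(1), of n 0] by (simp flip: power_mult_distrib)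
      then have "(- 1) ^ n * q ^ (n choose 2) * qp q q n = (- 1) ^ n * q ^ (n choose 2) * ?P" by simp
      also have "\<dots> = ((- 1) ^ n * (- 1) ^ n) * (qp (inverse (q ^ n)) q n
          * (q ^ (n choose 2) * q ^ (n choose 2) * q ^ n))"
        by (simp only: mult_ac)
      finally show ?thesis unfolding sq p mult_1_left by (rule sym)
    qed
    have "C n * inner n = qp X q n / (qp q q n * qp (q * b / e) q n * qp (q * b / f) q n)
        * (qp b q (2 * n) * (1 - b * q ^ (2 * n))) * (- 1) ^ n / q ^ (n choose 2)
        * ((qp (inverse (q ^ n)) q n * q ^ (n * n)) / qp (q ^ Suc n * b) q n)"
      unfolding C_def inner_def \<beta>_def g_def by (simp add: mult_ac)
    also have "\<dots> = ((- 1) ^ n * (- 1) ^ n) * (qp X q n / (qp (q * b / e) q n * qp (q * b / f) q n) * qp b q (Suc n))"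
      unfolding B e using nz nq q by (simp add: divide_simps)
    finally show ?thesis unfolding sq X_def by simp
  qed
  finally show ?thesis .
qed

section \<open>Watson's transformation\<close>

text \<open>This is \<open>phi43\<close> of argument \<open>q\<close> times \<open>(b1, b2, b3; q)\<^sub>n\<close>, cancelled termwise so that
  vanishing lower factorials cause no division by zero.\<close>

definition phi43_cleared :: "nat \<Rightarrow> complex \<Rightarrow> complex \<Rightarrow> complex \<Rightarrow> complex \<Rightarrow> complex \<Rightarrow> complex
    \<Rightarrow> complex \<Rightarrow> complex" where
  "phi43_cleared n a1 a2 a3 b1 b2 b3 q =
     (\<Sum>k\<le>n. qp (inverse (q ^ n)) q k * qp a1 q k * qp a2 q k * qp a3 q k / qp q q k
        * (qp (b1 * q ^ k) q (n - k) * qp (b2 * q ^ k) q (n - k) * qp (b3 * q ^ k) q (n - k)) * q ^ k)"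

lemma phi43_eq_cleared:
  assumes "phi43_defined n b1 b2 b3 q"
  shows "qp b1 q n * qp b2 q n * qp b3 q n * phi43 n a1 a2 a3 b1 b2 b3 q q
    = phi43_cleared n a1 a2 a3 b1 b2 b3 q"
proof -
  have nz: "qp b1 q k \<noteq> 0" "qp b2 q k \<noteq> 0" "qp b3 q k \<noteq> 0" if "k \<le> n" for k
    using assms that by (auto simp: phi43_defined_def)
  show ?thesis
    unfolding phi43_def phi43_cleared_def sum_distrib_left
    by (intro sum.cong refl) (simp add: nz qp_split[of _ n] mult_ac)
qed

text \<open>For each root t of b, (1 - t) (qt;q)_k = (t;q)_k (1 - t q^k). The product over both
  roots depends on b alone, so the branch of \<open>csqrt\<close> is immaterial.\<close>

lemma W87_summand:
  assumes "qp (csqrt b) q k * qp (- csqrt b) q k \<noteq> 0" "1 - b \<noteq> 0"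
  shows "qp (q * csqrt b) q k * qp (- q * csqrt b) q k / (qp (csqrt b) q k * qp (- csqrt b) q k)
    = (1 - b * q ^ (2 * k)) / (1 - b)"
proof -
  define s where "s = csqrt b"
  have b: "b = s * s" by (simp add: s_def flip: power2_eq_square)
  have shift: "(1 - t) * qp (q * t) q k = qp t q k * (1 - t * q ^ k)" for t
    using qp_Suc_left[of t q k] by (simp add: qp_Suc mult.commute)
  have "(1 - b) * (qp (q * s) q k * qp (- q * s) q k)
      = ((1 - s) * qp (q * s) q k) * ((1 - (- s)) * qp (q * - s) q k)"
    by (simp add: b algebra_simps)
  also have "\<dots> = qp s q k * qp (- s) q k * (1 - b * q ^ (2 * k))"
    unfolding shift by (simp add: b mult_2 mult_2_right power_add algebra_simps)
  finally show ?thesis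
    using assms by (simp add: s_def[symmetric] field_simps)
qed

text \<open>The pair c, d is expanded by \<open>q_saalschuetz\<close>, and the inner sum after the
  interchange is \<open>rogers_6phi5_sum\<close>. The usual prefactor contains (qb/(ef);q)_n; its
  reversal gives the powers on the right times (ef/(q^n b);q)_n, which \<open>phi43_cleared\<close>
  absorbs.\<close>

theorem watson_transformation:
  fixes q b c d e f :: complex
  assumes q: "q \<noteq> 0" "norm q \<noteq> 1" and b: "b \<noteq> 0" and dfd: "W87_defined b n c d e f q"
    and z: "z = q ^ (n + 2) * b ^ 2 / (c * d * e * f)"
  shows "W87 b n c d e f q z
      * (qp (q * b / c) q n * qp (q * b / d) q n * qp (q * b / e) q n * qp (q * b / f) q n)
    = qp (q * b) q n * (- (q * b / (e * f))) ^ n * q ^ (n choose 2)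
      * phi43_cleared n (q * b / (c * d)) e f (q * b / c) (q * b / d) (e * f / (q ^ n * b)) q"
proof (cases "n = 0")
  case True
  then show ?thesis by (simp add: W87_def phi43_cleared_def numeral_2_eq_2)
next
  case False
  have cdef: "c \<noteq> 0" "d \<noteq> 0" "e \<noteq> 0" "f \<noteq> 0"
    and nz: "\<And>k. k \<le> n \<Longrightarrow> qp (csqrt b) q k * qp (- csqrt b) q k \<noteq> 0"
      "qp (q ^ Suc n * b) q n \<noteq> 0"
      "qp (q * b / c) q n \<noteq> 0" "qp (q * b / d) q n \<noteq> 0"
      "qp (q * b / e) q n \<noteq> 0" "qp (q * b / f) q n \<noteq> 0"
    using dfd by (auto simp: W87_defined_def)
  \<comment> \<open>The denominator at k = 1 contains (1 - sqrt b)(1 + sqrt b). It is known to be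
    nonzero only when n > 0, hence the separate case n = 0.\<close>
  have b1: "1 - b \<noteq> 0"
  proof -
    have "(1 - csqrt b) * (1 + csqrt b) \<noteq> 0"
      using nz(1)[of 1] False by (simp add: qp_Suc)
    also have "(1 - csqrt b) * (1 + csqrt b) = 1 - b"
      by (simp add: algebra_simps flip: power2_eq_square)
    finally show ?thesis .
  qed
  define X where "X = q * b / (e * f)"
  define Y where "Y = q * b / (c * d)"
  have X: "X \<noteq> 0" using q b cdef by (simp add: X_def)
  \<comment> \<open>The argument z splits as (q^n X) Y: the power Y^k comes from expanding c, d, and
    the rest stays with e, f in \<open>g\<close>.\<close>
  define g where "g = (\<lambda>k. qp (inverse (q ^ n)) q k * qp e q k * qp f q k
      / (qp (q ^ Suc n * b) q k * qp (q * b / e) q k * qp (q * b / f) q k) * (q ^ n * X) ^ k)"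
  define \<beta> where "\<beta> = (\<lambda>j. qp Y q j / (qp q q j * qp (q * b / c) q j * qp (q * b / d) q j))"
  define B where "B = qp (q * b / c) q n * qp (q * b / d) q n * qp (q * b / e) q n * qp (q * b / f) q n"
  have "(1 - b) * W87 b n c d e f q z = (\<Sum>k\<le>n. (1 - b * q ^ (2 * k)) * qp b q k / qp q q k * g k
        * (\<Sum>j\<le>k. qp (inverse (q ^ k)) q j * qp (b * q ^ k) q j * \<beta> j * q ^ j))"
    unfolding W87_def
  proof (subst sum_distrib_left, intro sum.cong refl)
    fix k assume "k \<in> {..n}"
    then have k: "k \<le> n" by simp
    have S: "(\<Sum>j\<le>k. qp (inverse (q ^ k)) q j * qp (b * q ^ k) q j * \<beta> j * q ^ j)
        = qp c q k * qp d q k / (qp (q * b / c) q k * qp (q * b / d) q k) * Y ^ k"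
      using q_saalschuetz[OF q cdef(1,2) qp_nonzero_le[OF nz(3) k] qp_nonzero_le[OF nz(4) k]]
      unfolding \<beta>_def Y_def by simp
    have Z: "z ^ k = (q ^ n * X) ^ k * Y ^ k"
      unfolding z X_def Y_def power_mult_distrib[symmetric] by (simp add: power2_eq_square mult_ac)
    have "(1 - b) * (qp b q k * qp (q * csqrt b) q k * qp (- q * csqrt b) q k
               * qp (inverse (q ^ n)) q k * qp c q k * qp d q k * qp e q k * qp f q k
            / (qp q q k * qp (csqrt b) q k * qp (- csqrt b) q k * qp (q ^ (n + 1) * b) q k
               * qp (q * b / c) q k * qp (q * b / d) q k * qp (q * b / e) q k * qp (q * b / f) q k)
            * z ^ k)
      = (1 - b) * (qp (q * csqrt b) q k * qp (- q * csqrt b) q k / (qp (csqrt b) q k * qp (- csqrt b) q k))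
         * (qp b q k * qp (inverse (q ^ n)) q k * qp c q k * qp d q k * qp e q k * qp f q k
            / (qp q q k * qp (q ^ Suc n * b) q k
               * qp (q * b / c) q k * qp (q * b / d) q k * qp (q * b / e) q k * qp (q * b / f) q k)
            * z ^ k)"
      by (simp add: mult_ac)
    also have "\<dots> = (1 - b * q ^ (2 * k)) * (qp b q k * qp (inverse (q ^ n)) q k * qp c q k * qp d q k * qp e q k * qp f q k
            / (qp q q k * qp (q ^ Suc n * b) q k
               * qp (q * b / c) q k * qp (q * b / d) q k * qp (q * b / e) q k * qp (q * b / f) q k)
            * z ^ k)"
      unfolding W87_summand[OF nz(1)[OF k] b1] using b1 by simp
    also have "\<dots> = (1 - b * q ^ (2 * k)) * qp b q k / qp q q k * g k
        * (\<Sum>j\<le>k. qp (inverse (q ^ k)) q j * qp (b * q ^ k) q j * \<beta> j * q ^ j)"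
      unfolding S Z g_def by (simp add: mult_ac)
    finally show "(1 - b) * (qp b q k * qp (q * csqrt b) q k * qp (- q * csqrt b) q k
               * qp (inverse (q ^ n)) q k * qp c q k * qp d q k * qp e q k * qp f q k
            / (qp q q k * qp (csqrt b) q k * qp (- csqrt b) q k * qp (q ^ (n + 1) * b) q k
               * qp (q * b / c) q k * qp (q * b / d) q k * qp (q * b / e) q k * qp (q * b / f) q k)
            * z ^ k) = (1 - b * q ^ (2 * k)) * qp b q k / qp q q k * g k
        * (\<Sum>j\<le>k. qp (inverse (q ^ k)) q j * qp (b * q ^ k) q j * \<beta> j * q ^ j)" .
  qed
  also have "\<dots> = (\<Sum>j\<le>n. \<beta> j * qp b q (2 * j) * (- 1) ^ j / q ^ (j choose 2)
        * (\<Sum>m\<le>n - j. (1 - b * q ^ (2 * j) * q ^ (2 * m)) * qp (b * q ^ (2 * j)) q m / qp q q m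
            * (g (j + m) / q ^ (m * j))))"
    by (rule very_well_poised_interchange[OF q])
  finally have "(1 - b) * W87 b n c d e f q z * B
    = (\<Sum>j\<le>n. \<beta> j * qp b q (2 * j) * (- 1) ^ j / q ^ (j choose 2)
        * (\<Sum>m\<le>n - j. (1 - b * q ^ (2 * j) * q ^ (2 * m)) * qp (b * q ^ (2 * j)) q m / qp q q m
            * (g (j + m) / q ^ (m * j)))) * B"
    by (rule arg_cong)
  also have "\<dots> = (\<Sum>j\<le>n. qp b q (Suc n) * (- X) ^ n * q ^ (n choose 2)
      * (qp (inverse (q ^ n)) q j * qp Y q j * qp e q j * qp f q j / qp q q j
        * (qp (q * b / c * q ^ j) q (n - j) * qp (q * b / d * q ^ j) q (n - j)
          * qp (e * f / (q ^ n * b) * q ^ j) q (n - j)) * q ^ j))"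
    unfolding sum_distrib_right
  proof (intro sum.cong refl)
    fix j assume "j \<in> {..n}"
    then have j: "j \<le> n" by simp
    define N where "N = n - j"
    have n: "n = j + N" using j by (simp add: N_def)
    \<comment> \<open>The inner sum is a 6phi5 of length N with base b q^(2j) and parameters e q^j,
      f q^j; by \<open>s3\<close> the quotient X = qb/(ef) is unchanged.\<close>
    define b' where "b' = b * q ^ (2 * j)"
    have s1: "q ^ Suc n * b * q ^ j = q ^ Suc N * b'"
      by (simp add: b'_def n power_add mult_2 mult_2_right mult_ac)
    have s2: "q * b / e * q ^ j = q * b' / (e * q ^ j)" "q * b / f * q ^ j = q * b' / (f * q ^ j)"
      using q by (simp_all add: b'_def mult_2 power_add)
    have s3: "q ^ Suc N * b' / ((e * q ^ j) * (f * q ^ j)) = q ^ N * X"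
      "q * b' / ((e * q ^ j) * (f * q ^ j)) = X"
      using q by (simp_all add: b'_def mult_2 power_add X_def)
    have s4: "inverse (q ^ n) * q ^ j = inverse (q ^ N)"
      using q by (simp add: n power_add)
    have split: "qp v q n = qp v q j * qp (v * q ^ j) q N" for v
      using qp_add[of v q j N] by (simp add: n)
    have nz1: "qp (q ^ Suc n * b) q j \<noteq> 0" "qp (q ^ Suc N * b') q N \<noteq> 0"
      using nz(2) unfolding split s1[symmetric] by auto
    have nz2: "qp (q * b / e) q j \<noteq> 0" "qp (q * b' / (e * q ^ j)) q N \<noteq> 0"
      using nz(5) unfolding split s2[symmetric] by auto
    have nz3: "qp (q * b / f) q j \<noteq> 0" "qp (q * b' / (f * q ^ j)) q N \<noteq> 0"
      using nz(6) unfolding split s2[symmetric] by auto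
    have nz4: "qp (q * b / c) q j \<noteq> 0" "qp (q * b / d) q j \<noteq> 0"
      using nz(3,4) unfolding split by auto
    define G where "G = qp (inverse (q ^ n)) q j * qp e q j * qp f q j
        / (qp (q ^ Suc n * b) q j * qp (q * b / e) q j * qp (q * b / f) q j) * (q ^ n * X) ^ j"
    have g: "g (j + m) / q ^ (m * j) = G * (qp (inverse (q ^ N)) q m * qp (e * q ^ j) q m * qp (f * q ^ j) q m
          / (qp (q ^ Suc N * b') q m * qp (q * b' / (e * q ^ j)) q m * qp (q * b' / (f * q ^ j)) q m)
          * (q ^ Suc N * b' / ((e * q ^ j) * (f * q ^ j))) ^ m)" for m
    proof -
      have p: "(q ^ n * X) ^ (j + m) = (q ^ n * X) ^ j * (q ^ N * X) ^ m * q ^ (m * j)"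
        by (simp add: n power_add power_mult_distrib mult_ac flip: power_mult)
      show ?thesis
        unfolding g_def G_def qp_add s1 s2 s4 s3 p using q by (simp add: mult_ac)
    qed
    have inner: "(\<Sum>m\<le>N. (1 - b' * q ^ (2 * m)) * qp b' q m / qp q q m * (g (j + m) / q ^ (m * j)))
      = G * (qp b' q (Suc N) * qp X q N / (qp (q * b' / (e * q ^ j)) q N * qp (q * b' / (f * q ^ j)) q N))"
    proof -
      have "(\<Sum>m\<le>N. (1 - b' * q ^ (2 * m)) * qp b' q m / qp q q m * (g (j + m) / q ^ (m * j)))
        = G * (\<Sum>m\<le>N. (1 - b' * q ^ (2 * m)) * qp b' q m / qp q q m
          * (qp (inverse (q ^ N)) q m * qp (e * q ^ j) q m * qp (f * q ^ j) q m
          / (qp (q ^ Suc N * b') q m * qp (q * b' / (e * q ^ j)) q m * qp (q * b' / (f * q ^ j)) q m)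
          * (q ^ Suc N * b' / ((e * q ^ j) * (f * q ^ j))) ^ m))"
        unfolding g sum_distrib_left by (intro sum.cong refl) (simp only: mult_ac)
      also have "\<dots> = G * (qp b' q (Suc N) * qp (q * b' / ((e * q ^ j) * (f * q ^ j))) q N
          / (qp (q * b' / (e * q ^ j)) q N * qp (q * b' / (f * q ^ j)) q N))"
        using q cdef nz1 nz2 nz3 by (subst rogers_6phi5_sum) auto
      finally show ?thesis unfolding s3 .
    qed
    \<comment> \<open>Both sides are (b;q)_(n+1+j); the factor (q^(n+1) b;q)_j then cancels the
      denominator in \<open>G\<close>.\<close>
    have bb: "qp b q (2 * j) * qp b' q (Suc N) = qp b q (Suc n) * qp (q ^ Suc n * b) q j"
    proof -
      have "2 * j + Suc N = Suc n + j" by (simp add: n)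
      then show ?thesis
        using qp_add[of b q "2 * j" "Suc N"] qp_add[of b q "Suc n" j]
        by (simp only: b'_def mult.commute[of b])
    qed
    \<comment> \<open>Reversing (X;q)_N produces the tail of (ef/(q^n b);q)_n that the cleared
      series needs; the remaining powers collect into q^j times a factor independent of j.\<close>
    have rv: "(- 1) ^ j / q ^ (j choose 2) * (q ^ n * X) ^ j * qp X q N
      = (- X) ^ n * q ^ (n choose 2) * q ^ j * qp (e * f / (q ^ n * b) * q ^ j) q N"
    proof -
      have a: "e * f / (q ^ n * b) * q ^ j = q / (q ^ N * X)"
        using q b cdef by (simp add: X_def n power_add)
      have p: "q ^ (n * j) * q ^ (N choose 2) = q ^ (n choose 2) * q ^ j * q ^ (j choose 2)"
      proof -
        have "n * j + (N choose 2) = (n choose 2) + j + (j choose 2)"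
          unfolding n choose_two_add using choose_two_double[of j] by (simp add: algebra_simps)
        then show ?thesis by (metis power_add)
      qed
      have "(- 1) ^ j * (q ^ n * X) ^ j * qp X q N
        = ((- X) ^ j * (- X) ^ N) * (q ^ (n * j) * q ^ (N choose 2)) * qp (q / (q ^ N * X)) q N"
      proof -
        have "(q ^ n * X) ^ j = q ^ (n * j) * X ^ j" "(- X) ^ j = (- 1) ^ j * X ^ j"
          by (simp_all only: power_mult_distrib power_mult power_minus[of X])
        then show ?thesis
          by (subst qp_reverse[OF X q(1)]) (simp only: mult_ac)
      qed
      also have "\<dots> = (- X) ^ n * (q ^ (n choose 2) * q ^ j * q ^ (j choose 2)) * qp (q / (q ^ N * X)) q N"
        unfolding p by (simp only: n power_add)
      finally show ?thesis
        unfolding a using q by (simp add: divide_simps mult_ac)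
    qed
    have "\<beta> j * qp b q (2 * j) * (- 1) ^ j / q ^ (j choose 2)
        * (G * (qp b' q (Suc N) * qp X q N / (qp (q * b' / (e * q ^ j)) q N * qp (q * b' / (f * q ^ j)) q N))) * B
      = (qp b q (2 * j) * qp b' q (Suc N)) * ((- 1) ^ j / q ^ (j choose 2) * (q ^ n * X) ^ j * qp X q N)
        * (qp (inverse (q ^ n)) q j * qp Y q j * qp e q j * qp f q j / qp q q j
           * (qp (q * b / c * q ^ j) q N * qp (q * b / d * q ^ j) q N)) / qp (q ^ Suc n * b) q j"
      unfolding B_def split \<beta>_def G_def s2 using nz2 nz3 nz4 by (simp add: mult_ac)
    also have "\<dots> = qp b q (Suc n) * (- X) ^ n * q ^ (n choose 2)
      * (qp (inverse (q ^ n)) q j * qp Y q j * qp e q j * qp f q j / qp q q j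
        * (qp (q * b / c * q ^ j) q N * qp (q * b / d * q ^ j) q N
          * qp (e * f / (q ^ n * b) * q ^ j) q N) * q ^ j)"
      unfolding bb rv using nz1 by (simp add: mult_ac)
    finally show "\<beta> j * qp b q (2 * j) * (- 1) ^ j / q ^ (j choose 2)
        * (\<Sum>m\<le>n - j. (1 - b * q ^ (2 * j) * q ^ (2 * m)) * qp (b * q ^ (2 * j)) q m / qp q q m
            * (g (j + m) / q ^ (m * j))) * B = qp b q (Suc n) * (- X) ^ n * q ^ (n choose 2)
      * (qp (inverse (q ^ n)) q j * qp Y q j * qp e q j * qp f q j / qp q q j
        * (qp (q * b / c * q ^ j) q (n - j) * qp (q * b / d * q ^ j) q (n - j)
          * qp (e * f / (q ^ n * b) * q ^ j) q (n - j)) * q ^ j)"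
      unfolding N_def[symmetric] b'_def[symmetric] inner .
  qed
  also have "\<dots> = (1 - b) * (qp (q * b) q n * (- X) ^ n * q ^ (n choose 2)
      * phi43_cleared n Y e f (q * b / c) (q * b / d) (e * f / (q ^ n * b)) q)"
  proof -
    have "qp b q (Suc n) = (1 - b) * qp (q * b) q n"
      by (simp only: qp_Suc_left mult.commute)
    then show ?thesis
      unfolding phi43_cleared_def sum_distrib_left by (intro sum.cong refl) (simp only: mult.assoc)
  qed
  finally show ?thesis
    unfolding B_def X_def Y_def using b1 by (simp add: mult.assoc)
qed

section \<open>Cancellation of powers of q, and reversal of a balanced 4phi3\<close>

lemma power_choose_two_square:
  fixes q :: complex
  assumes "q \<noteq> 0"
  shows "(q / q ^ n) ^ n * (q ^ (n choose 2) * q ^ (n choose 2)) = 1"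
proof -
  have "q ^ n * (q ^ (n choose 2) * q ^ (n choose 2)) = q ^ (n * n)"
    by (simp add: add_ac flip: power_add choose_two_double mult_2)
  then show ?thesis
    using assms by (simp add: power_divide power_mult)
qed

text \<open>Under k = n - m, lower parameters b become upper ones q^(1-n)/b, and upper ones a become
  lower ones q^(1-n)/a. The balancing condition keeps the argument equal to q.\<close>

lemma phi43_cleared_reverse:
  fixes q :: complex
  assumes q: "q \<noteq> 0" "norm q \<noteq> 1"
    and nz: "a1 \<noteq> 0" "a2 \<noteq> 0" "a3 \<noteq> 0" "b1 \<noteq> 0" "b2 \<noteq> 0" "b3 \<noteq> 0"
    and balanced: "q * (a1 * a2 * a3) = q ^ n * (b1 * b2 * b3)"
  shows "(q ^ (n choose 2)) ^ 4 * (b1 * b2 * b3) ^ n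
      * phi43_cleared n (q / (q ^ n * b1)) (q / (q ^ n * b2)) (q / (q ^ n * b3))
          (q / (q ^ n * a1)) (q / (q ^ n * a2)) (q / (q ^ n * a3)) q
    = phi43_cleared n a1 a2 a3 b1 b2 b3 q"
proof -
  define T where "T = (\<lambda>k. qp (inverse (q ^ n)) q k * qp (q / (q ^ n * b1)) q k
      * qp (q / (q ^ n * b2)) q k * qp (q / (q ^ n * b3)) q k / qp q q k
      * (qp (q / (q ^ n * a1) * q ^ k) q (n - k) * qp (q / (q ^ n * a2) * q ^ k) q (n - k)
        * qp (q / (q ^ n * a3) * q ^ k) q (n - k)) * q ^ k)"
  define K where "K = q ^ (n choose 2)"
  have K: "K \<noteq> 0" using q by (simp add: K_def)
  \<comment> \<open>Three factors \<open>K\<close> come from the pairs (a_i, b_i); the fourth arises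
    from (q^(-n);q)_m / (q;q)_m together with balancing.\<close>
  have term_eq: "K ^ 4 * (b1 * b2 * b3) ^ n * T (n - m)
      = qp (inverse (q ^ n)) q m * qp a1 q m * qp a2 q m * qp a3 q m / qp q q m
        * (qp (b1 * q ^ m) q (n - m) * qp (b2 * q ^ m) q (n - m) * qp (b3 * q ^ m) q (n - m)) * q ^ m"
    if m: "m \<le> n" for m
  proof -
    define k where "k = n - m"
    have n: "n = k + m" "n - k = m" "n - m = k" using m by (simp_all add: k_def)
    have upper: "qp (b * q ^ m) q k = (- b) ^ k * q ^ (m * k) * q ^ (k choose 2) * qp (q / (q ^ n * b)) q k"
      if "b \<noteq> 0" for b
    proof -
      have arg: "q / (q ^ k * (b * q ^ m)) = q / (q ^ n * b)"
        by (simp add: n(1) power_add mult_ac)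
      have pw: "(- (b * q ^ m)) ^ k = (- b) ^ k * q ^ (m * k)"
        by (metis mult_minus_left power_mult power_mult_distrib)
      show ?thesis
        using qp_reverse[of "b * q ^ m" q k] that q unfolding arg pw by simp
    qed
    have lower: "qp a q m = (- a) ^ m * q ^ (m choose 2) * qp (q / (q ^ n * a) * q ^ k) q m"
      if "a \<noteq> 0" for a
    proof -
      have "q / (q ^ n * a) * q ^ k = q / (q ^ m * a)"
        using q that by (simp add: n(1) power_add field_simps)
      then show ?thesis
        using qp_reverse[OF that q(1), of m] by simp
    qed
    have Q: "qp q q k \<noteq> 0" "qp q q m \<noteq> 0" using qp_q_q_nonzero[OF q(2)] by auto
    \<comment> \<open>Times q^(m k), both sides equal (q;q)_n.\<close>
    have first: "qp (inverse (q ^ n)) q m * ((- q) ^ m * q ^ (m choose 2)) * qp q q k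
        = qp (inverse (q ^ n)) q k * ((- q) ^ k * q ^ (k choose 2)) * qp q q m"
    proof -
      have "qp (inverse (q ^ n)) q m * ((- q) ^ m * q ^ (m choose 2)) * qp q q k * q ^ (m * k)
          = qp (inverse (q ^ n)) q k * ((- q) ^ k * q ^ (k choose 2)) * qp q q m * q ^ (m * k)"
        using qp_inverse_power[OF q(1), of m k] qp_inverse_power[OF q(1), of k m]
        by (simp add: n(1) mult_ac add_ac)
      then show ?thesis using q by simp
    qed
    \<comment> \<open>Balancing enters here: it trades the m-th powers of the a_i for those of the
      b_i, completing the n-th power.\<close>
    have al: "(a1 * a2 * a3) ^ m * q ^ m = q ^ (n * m) * (b1 * b2 * b3) ^ m"
      using arg_cong[OF balanced, of "\<lambda>v. v ^ m"] by (simp add: power_mult_distrib mult_ac flip: power_mult)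
    have KK: "K = q ^ (k choose 2) * q ^ (m choose 2) * q ^ (m * k)"
      by (simp add: K_def n(1) choose_two_add power_add mult_ac)
    have nm: "q ^ (n * m) = q ^ (m * k) * (q ^ (m choose 2) * q ^ (m choose 2) * q ^ m)"
      by (simp add: n(1) algebra_simps mult_2 flip: power_add choose_two_double)
    have sgn: "(- 1) ^ m * (- 1) ^ m = (1 :: complex)" "(- 1) ^ k * (- 1) ^ k = (1 :: complex)"
      by (simp_all flip: power_mult_distrib)
    define P where "P = qp (q / (q ^ n * b1)) q k * qp (q / (q ^ n * b2)) q k * qp (q / (q ^ n * b3)) q k
        * (qp (q / (q ^ n * a1) * q ^ k) q m * qp (q / (q ^ n * a2) * q ^ k) q m
          * qp (q / (q ^ n * a3) * q ^ k) q m)"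
    have T: "T k = qp (inverse (q ^ n)) q k / qp q q k * q ^ k * P"
      unfolding T_def P_def n(2) by (simp add: mult_ac)
    have first': "qp (inverse (q ^ n)) q m / qp q q m * ((- 1) ^ m * q ^ m * q ^ (m choose 2))
        = qp (inverse (q ^ n)) q k / qp q q k * ((- 1) ^ k * q ^ k * q ^ (k choose 2))"
      using first Q by (simp add: frac_eq_eq power_minus[of q] mult_ac)
    define W where "W = qp (inverse (q ^ n)) q m / qp q q m"
    define V where "V = qp (inverse (q ^ n)) q k / qp q q k"
    have W: "W * ((- 1) ^ m * q ^ m * q ^ (m choose 2)) = V * ((- 1) ^ k * q ^ k * q ^ (k choose 2))"
      using first' by (simp only: W_def V_def)
    have "qp (inverse (q ^ n)) q m * qp a1 q m * qp a2 q m * qp a3 q m / qp q q m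
        * (qp (b1 * q ^ m) q k * qp (b2 * q ^ m) q k * qp (b3 * q ^ m) q k) * q ^ m
      = W * (qp a1 q m * qp a2 q m * qp a3 q m
        * (qp (b1 * q ^ m) q k * qp (b2 * q ^ m) q k * qp (b3 * q ^ m) q k)) * q ^ m"
      by (simp add: W_def)
    also have "\<dots> = W * (((- a1) ^ m * (- a2) ^ m * (- a3) ^ m) * ((- b1) ^ k * (- b2) ^ k * (- b3) ^ k)
        * (q ^ (m choose 2) * q ^ (k choose 2) * q ^ (m * k)) ^ 3 * P) * q ^ m"
      by (simp add: lower[OF nz(1)] lower[OF nz(2)] lower[OF nz(3)] upper[OF nz(4)] upper[OF nz(5)]
          upper[OF nz(6)] P_def power3_eq_cube mult_ac)
    also have "\<dots> = W * (((- 1) ^ m * (- 1) ^ m * (- 1) ^ m * (a1 * a2 * a3) ^ m)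
        * ((- 1) ^ k * (- 1) ^ k * (- 1) ^ k * (b1 * b2 * b3) ^ k) * K ^ 3 * P) * q ^ m"
      by (simp only: KK power_minus[of a1] power_minus[of a2] power_minus[of a3]
          power_minus[of b1] power_minus[of b2] power_minus[of b3] power_mult_distrib mult_ac)
    also have "\<dots> = W * (-1) ^ m * (-1) ^ k * ((a1 * a2 * a3) ^ m * q ^ m) * (b1 * b2 * b3) ^ k * K ^ 3 * P"
      unfolding sgn by (simp add: mult_ac)
    also have "\<dots> = (W * ((- 1) ^ m * q ^ m * q ^ (m choose 2))) * (-1) ^ k * q ^ (m * k) * q ^ (m choose 2)
        * ((b1 * b2 * b3) ^ k * (b1 * b2 * b3) ^ m) * K ^ 3 * P"
      unfolding al nm by (simp only: mult_ac)
    also have "\<dots> = V * ((- 1) ^ k * (- 1) ^ k) * q ^ k * K * (b1 * b2 * b3) ^ n * K ^ 3 * P"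
      unfolding W by (simp only: KK[symmetric] n(1) power_add mult_ac) (simp add: KK mult_ac)
    also have "\<dots> = K ^ 4 * (b1 * b2 * b3) ^ n * T k"
      unfolding sgn T V_def by (simp add: power3_eq_cube power4_eq_xxxx mult_ac)
    finally show ?thesis unfolding n(3) by simp
  qed
  have "K ^ 4 * (b1 * b2 * b3) ^ n * (\<Sum>k\<le>n. T k) = K ^ 4 * (b1 * b2 * b3) ^ n * (\<Sum>m\<le>n. T (n - m))"
    by (subst sum.nat_diff_reindex[where n = "Suc n", simplified lessThan_Suc_atMost, symmetric]) simp
  also have "\<dots> = phi43_cleared n a1 a2 a3 b1 b2 b3 q"
    unfolding phi43_cleared_def sum_distrib_left by (intro sum.cong refl) (simp add: term_eq)
  finally show ?thesis
    unfolding T_def phi43_cleared_def K_def .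
qed

text \<open>Watson's transformation expands c, d and keeps e, f. Exchanging c and f makes e, c the
  kept pair, which gives a second balanced series with the same value.\<close>

lemma W87_exchange: "W87 b n c d e f q z = W87 b n f d e c q z"
  by (simp add: W87_def mult_ac)

lemma W87_defined_exchange: "W87_defined b n c d e f q = W87_defined b n f d e c q"
  by (auto simp add: W87_defined_def mult_ac)

text \<open>The equations \<open>args\<close> allow the simplified form of every parameter to be
  prescribed, so each use leaves only field identities. The left side is the same for every
  pairing.\<close>

lemma watson_transformation_quotient:
  fixes q b c d e f :: complex
  assumes q: "q \<noteq> 0" "norm q \<noteq> 1" and b: "b \<noteq> 0" and dfd: "W87_defined b n c d e f q"
    and z: "z = q ^ (n + 2) * b ^ 2 / (c * d * e * f)" and nz: "qp (q * b) q n \<noteq> 0"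
    and args: "q * b / (c * d) = va" "q * b / c = wa" "q * b / d = wb" "e * f / (q ^ n * b) = wc"
      "q * b / e = wd" "q * b / f = we" "q * b / (e * f) = y"
  shows "W87 b n c d e f q z * (qp wa q n * qp wb q n * qp wd q n * qp we q n) / qp (q * b) q n
    = (- y) ^ n * q ^ (n choose 2) * phi43_cleared n va e f wa wb wc q"
  using watson_transformation[OF q b dfd z] nz unfolding args by simp

section \<open>Representations of the Askey--Wilson polynomials\<close>

text \<open>Here z stands for e^(i theta) and p, r, t, u for parameter values; the factorials (pr,
  pt, pu;q)_n are absorbed by the cleared series.\<close>

definition AW_cleared :: "nat \<Rightarrow> complex \<Rightarrow> complex \<Rightarrow> complex \<Rightarrow> complex \<Rightarrow> complex \<Rightarrow> complex
    \<Rightarrow> complex" where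
  "AW_cleared n q z p r t u = inverse (p ^ n)
    * phi43_cleared n (q ^ n / q * (p * r * t * u)) (p * z) (p / z) (p * r) (p * t) (p * u) q"

text \<open>The prefactor is what remains of z^n (t/z, u/z;q)_n once both factorials are reversed
  and absorbed as lower factorials of the series.\<close>

definition rep2_cleared :: "nat \<Rightarrow> complex \<Rightarrow> complex \<Rightarrow> complex \<Rightarrow> complex \<Rightarrow> complex \<Rightarrow> complex
    \<Rightarrow> complex" where
  "rep2_cleared n q z p r t u = (t * u / z) ^ n * (q ^ (n choose 2) * q ^ (n choose 2))
    * phi43_cleared n (p * z) (r * z) (q / q ^ n / (t * u)) (p * r) (q / q ^ n * z / t) (q / q ^ n * z / u) q"

context
  fixes n :: nat and q z p r t u :: complex
  assumes q: "q \<noteq> 0" "norm q \<noteq> 1" and z: "z \<noteq> 0"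
    and a: "p \<noteq> 0" "r \<noteq> 0" "t \<noteq> 0" "u \<noteq> 0"
begin

text \<open>Keeping the pair pz, p/z in Watson's transformation yields the defining series; keeping
  pz, q^(1-n)/(rt) yields the second representation. This links the two families.\<close>

lemma rep5_eq_cleared:
  assumes nz: "qp (r / p) q n \<noteq> 0"
    and dfd: "W87_defined (inverse (q ^ n) * p / r) n (q / q ^ n / (r * t)) (q / q ^ n / (r * u))
      (p * z) (p / z) q"
  defines "R \<equiv> inverse (p ^ n) * (qp (p * t) q n * qp (p * u) q n * qp (r * z) q n * qp (r / z) q n)
      / qp (r / p) q n * W87 (inverse (q ^ n) * p / r) n (q / q ^ n / (r * t)) (q / q ^ n / (r * u))
      (p * z) (p / z) q (q ^ n * t * u)"
  shows "R = AW_cleared n q z p r t u" "R = rep2_cleared n q z p u r t"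
proof -
  define b where "b = inverse (q ^ n) * p / r"
  define K where "K = q ^ (n choose 2)"
  have K: "K \<noteq> 0" using q by (simp add: K_def)
  have b: "b \<noteq> 0" using q a by (simp add: b_def)
  have e1: "qp (r * z) q n = (- (r * z)) ^ n * K * qp (q / q ^ n / (r * z)) q n"
    using qp_reverse[of "r * z" q n] q a z by (simp add: K_def)
  have e2: "qp (r / z) q n = (- (r / z)) ^ n * K * qp (q / q ^ n * z / r) q n"
    using qp_reverse[of "r / z" q n] q a z by (simp add: K_def)
  have e3: "qp (r / p) q n = (- (r / p)) ^ n * K * qp (q * b) q n"
    using qp_reverse[of "r / p" q n] q a z by (simp add: K_def b_def field_simps)
  have nz': "qp (q * b) q n \<noteq> 0" using nz e3 by auto
  have pw: "inverse (p ^ n) * (- (r * z)) ^ n * (- (r / z)) ^ n / (- (r / p)) ^ n = (- r) ^ n"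
  proof -
    have "inverse p * (- (r * z)) * (- (r / z)) / (- (r / p)) = - r"
      using a z by (simp add: field_simps)
    then show ?thesis by (metis power_divide power_inverse power_mult_distrib)
  qed
  define W where "W = W87 b n (q / q ^ n / (r * t)) (q / q ^ n / (r * u)) (p * z) (p / z) q (q ^ n * t * u)"
  \<comment> \<open>\<open>V\<close> is the left side of
    \<open>watson_transformation_quotient\<close>; the two pairings only permute its four
    factorials, so both evaluate the same \<open>V\<close>.\<close>
  define V where "V = W * (qp (p * t) q n * qp (p * u) q n * qp (q / q ^ n / (r * z)) q n
      * qp (q / q ^ n * z / r) q n) / qp (q * b) q n"
  have "R = (inverse (p ^ n) * (- (r * z)) ^ n * (- (r / z)) ^ n / (- (r / p)) ^ n) * K * V"
    unfolding R_def b_def[symmetric] W_def[symmetric] V_def e1 e2 e3 using K by (simp add: mult_ac)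
  then have R: "R = (- r) ^ n * K * V" unfolding pw .
  have V1: "V = (- (q / q ^ n / (r * p))) ^ n * K
      * phi43_cleared n (q ^ n / q * (p * r * t * u)) (p * z) (p / z) (p * t) (p * u) (p * r) q"
    using watson_transformation_quotient[OF q b dfd[folded b_def] _ nz', where z = "q ^ n * t * u"
        and va = "q ^ n / q * (p * r * t * u)" and wa = "p * t" and wb = "p * u" and wc = "p * r"
        and wd = "q / q ^ n / (r * z)" and we = "q / q ^ n * z / r" and y = "q / q ^ n / (r * p)"]
      q a z
    by (simp add: V_def W_def K_def b_def field_simps power2_eq_square)
  show "R = AW_cleared n q z p r t u"
  proof -
    have "(- r) ^ n * (- (q / q ^ n / (r * p))) ^ n = inverse (p ^ n) * (q / q ^ n) ^ n"
    proof -
      have "(- r) * (- (q / q ^ n / (r * p))) = inverse p * (q / q ^ n)"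
        using a q by (simp add: field_simps)
      then show ?thesis by (metis power_inverse power_mult_distrib)
    qed
    then have "R = inverse (p ^ n) * ((q / q ^ n) ^ n * (K * K))
        * phi43_cleared n (q ^ n / q * (p * r * t * u)) (p * z) (p / z) (p * t) (p * u) (p * r) q"
      unfolding R V1 by (simp add: mult_ac)
    then show ?thesis
      unfolding K_def power_choose_two_square[OF q(1)] AW_cleared_def
      by (simp add: phi43_cleared_def mult_ac)
  qed
  have dfd2: "W87_defined b n (p / z) (q / q ^ n / (r * u)) (p * z) (q / q ^ n / (r * t)) q"
    using dfd unfolding b_def by (rule W87_defined_exchange[THEN iffD1])
  have W2: "W = W87 b n (p / z) (q / q ^ n / (r * u)) (p * z) (q / q ^ n / (r * t)) q (q ^ n * t * u)"
    unfolding W_def by (rule W87_exchange)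
  have V2: "V = (- (t / z)) ^ n * K
      * phi43_cleared n (u * z) (p * z) (q / q ^ n / (r * t)) (q / q ^ n * z / r) (p * u) (q / q ^ n * z / t) q"
    using watson_transformation_quotient[OF q b dfd2 _ nz', where z = "q ^ n * t * u"
        and va = "u * z" and wa = "q / q ^ n * z / r" and wb = "p * u" and wc = "q / q ^ n * z / t"
        and wd = "q / q ^ n / (r * z)" and we = "p * t" and y = "t / z"]
      q a z
    by (simp add: V_def W2 K_def b_def field_simps power2_eq_square)
  show "R = rep2_cleared n q z p u r t"
  proof -
    have "(- r) ^ n * (- (t / z)) ^ n = (r * t / z) ^ n"
      by (simp flip: power_mult_distrib)
    then have "R = (r * t / z) ^ n * (K * K)
        * phi43_cleared n (u * z) (p * z) (q / q ^ n / (r * t)) (q / q ^ n * z / r) (p * u) (q / q ^ n * z / t) q"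
      unfolding R V2 by (simp add: mult_ac)
    then show ?thesis
      unfolding rep2_cleared_def K_def by (simp add: phi43_cleared_def mult_ac)
  qed
qed

text \<open>The kept pair is tz, uz. As the left side is symmetric in all four parameters, it is a
  common value for every instance of \<open>rep2_cleared\<close>.\<close>

lemma rep6_eq_cleared:
  assumes nz: "qp (inverse (z ^ 2)) q n \<noteq> 0"
    and dfd: "W87_defined (inverse (q ^ n) * z ^ 2) n (p * z) (r * z) (t * z) (u * z) q"
  shows "z ^ n * (qp (p / z) q n * qp (r / z) q n * qp (t / z) q n * qp (u / z) q n)
      / qp (inverse (z ^ 2)) q n * W87 (inverse (q ^ n) * z ^ 2) n (p * z) (r * z) (t * z) (u * z) q
      (q ^ 2 / q ^ n / (p * r * t * u)) = rep2_cleared n q z t u p r" (is "?R = _")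
proof -
  define b where "b = inverse (q ^ n) * z ^ 2"
  define K where "K = q ^ (n choose 2)"
  have K: "K \<noteq> 0" using q by (simp add: K_def)
  have b: "b \<noteq> 0" using q z by (simp add: b_def)
  have e: "qp (x / z) q n = (- (x / z)) ^ n * K * qp (q / q ^ n * z / x) q n" if "x \<noteq> 0" for x
    using qp_reverse[of "x / z" q n] q that z by (simp add: K_def)
  have e5: "qp (inverse (z ^ 2)) q n = (- (inverse (z ^ 2))) ^ n * K * qp (q * b) q n"
    using qp_reverse[of "inverse (z ^ 2)" q n] q z by (simp add: K_def b_def field_simps)
  have nz': "qp (q * b) q n \<noteq> 0" using nz e5 by auto
  define W where "W = W87 b n (p * z) (r * z) (t * z) (u * z) q (q ^ 2 / q ^ n / (p * r * t * u))"
  define V where "V = W * (qp (q / q ^ n * z / p) q n * qp (q / q ^ n * z / r) q n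
      * qp (q / q ^ n * z / t) q n * qp (q / q ^ n * z / u) q n) / qp (q * b) q n"
  have V: "V = (- (q / q ^ n / (t * u))) ^ n * K * phi43_cleared n (q / q ^ n / (p * r)) (t * z) (u * z)
      (q / q ^ n * z / p) (q / q ^ n * z / r) (t * u) q"
    using watson_transformation_quotient[OF q b dfd[folded b_def] _ nz',
        where z = "q ^ 2 / q ^ n / (p * r * t * u)"
        and va = "q / q ^ n / (p * r)" and wa = "q / q ^ n * z / p" and wb = "q / q ^ n * z / r"
        and wc = "t * u" and wd = "q / q ^ n * z / t" and we = "q / q ^ n * z / u"
        and y = "q / q ^ n / (t * u)"] q a z
    by (simp add: V_def W_def K_def b_def field_simps power2_eq_square)
  have pw: "z ^ n * (- (p / z)) ^ n * (- (r / z)) ^ n * (- (t / z)) ^ n * (- (u / z)) ^ n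
      / (- (inverse (z ^ 2))) ^ n * (- (q / q ^ n / (t * u))) ^ n = (p * r / z) ^ n * (q / q ^ n) ^ n"
  proof -
    have "z * (- (p / z)) * (- (r / z)) * (- (t / z)) * (- (u / z))
      / (- (inverse (z ^ 2))) * (- (q / q ^ n / (t * u))) = p * r / z * (q / q ^ n)"
      using q a z by (simp add: field_simps power2_eq_square)
    then show ?thesis by (metis power_divide power_mult_distrib)
  qed
  have "?R = (z ^ n * (- (p / z)) ^ n * (- (r / z)) ^ n * (- (t / z)) ^ n * (- (u / z)) ^ n
      / (- (inverse (z ^ 2))) ^ n) * (K * K * K) * V"
    unfolding b_def[symmetric] W_def[symmetric] V_def e[OF a(1)] e[OF a(2)] e[OF a(3)] e[OF a(4)] e5
    using K by (simp add: mult_ac)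
  also have "\<dots> = (z ^ n * (- (p / z)) ^ n * (- (r / z)) ^ n * (- (t / z)) ^ n * (- (u / z)) ^ n
      / (- (inverse (z ^ 2))) ^ n * (- (q / q ^ n / (t * u))) ^ n) * (K * K) * (K * K)
      * phi43_cleared n (q / q ^ n / (p * r)) (t * z) (u * z)
      (q / q ^ n * z / p) (q / q ^ n * z / r) (t * u) q"
    unfolding V by (simp only: mult_ac)
  \<comment> \<open>Grouped so that two of the four factors \<open>K\<close> cancel against
    (q^(1-n))^n by \<open>power_choose_two_square\<close>.\<close>
  also have "\<dots> = ((q / q ^ n) ^ n * (K * K)) * ((p * r / z) ^ n * (K * K))
      * phi43_cleared n (q / q ^ n / (p * r)) (t * z) (u * z)
      (q / q ^ n * z / p) (q / q ^ n * z / r) (t * u) q"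
    unfolding pw by (simp only: mult_ac)
  finally show ?thesis
    unfolding K_def power_choose_two_square[OF q(1)] rep2_cleared_def
    by (simp add: phi43_cleared_def mult_ac)
qed

text \<open>Keeping uz, q^(n-1) A gives the defining series based at u instead of p; keeping uz, rz
  gives the second representation. Hence series based at different parameters become
  comparable.\<close>

lemma rep4_eq_cleared:
  defines "A \<equiv> p * r * t * u"
  assumes nz: "qp (A * z / p) q n \<noteq> 0"
    and dfd: "W87_defined (A * z / (q * p)) n (r * z) (t * z) (u * z) (q ^ n / q * A) q"
  defines "R \<equiv> z ^ n * (qp (p / z) q n * qp (A / (p * r)) q n * qp (A / (p * t)) q n * qp (A / (p * u)) q n)
      / qp (A * z / p) q n * W87 (A * z / (q * p)) n (r * z) (t * z) (u * z) (q ^ n / q * A) q (q / z / p)"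
  shows "R = AW_cleared n q z u p r t" "R = rep2_cleared n q z u r p t"
proof -
  define b where "b = A * z / (q * p)"
  define f where "f = q ^ n / q * A"
  define K where "K = q ^ (n choose 2)"
  have K: "K \<noteq> 0" using q by (simp add: K_def)
  have b: "b \<noteq> 0" using q z a by (simp add: b_def A_def)
  have e: "qp (p / z) q n = (- (p / z)) ^ n * K * qp (q / q ^ n * z / p) q n"
    using qp_reverse[of "p / z" q n] q a z by (simp add: K_def)
  have e5: "A * z / p = q * b"
    using q by (simp add: b_def)
  have nz': "qp (q * b) q n \<noteq> 0" using nz e5 by auto
  define W where "W = W87 b n (r * z) (t * z) (u * z) f q (q / z / p)"
  define V where "V = W * (qp (t * u) q n * qp (r * u) q n * qp (r * t) q n
      * qp (q / q ^ n * z / p) q n) / qp (q * b) q n"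
  have pw: "z ^ n * (- (p / z)) ^ n = (- p) ^ n"
    using z by (simp flip: power_mult_distrib)
  have As: "A / (p * r) = t * u" "A / (p * t) = r * u" "A / (p * u) = r * t"
    using a by (simp_all add: A_def)
  have "R = (z ^ n * (- (p / z)) ^ n) * K * V"
    unfolding R_def b_def[symmetric] f_def[symmetric] W_def[symmetric] V_def e e5 As
    by (simp add: mult_ac)
  then have R: "R = (- p) ^ n * K * V" unfolding pw .
  have V1: "V = (- (q / q ^ n / (p * u))) ^ n * K
      * phi43_cleared n (u / z) (u * z) f (t * u) (r * u) (p * u) q"
    using watson_transformation_quotient[OF q b dfd[folded b_def f_def] _ nz', where z = "q / z / p"
        and va = "u / z" and wa = "t * u" and wb = "r * u"
        and wc = "p * u" and wd = "r * t" and we = "q / q ^ n * z / p"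
        and y = "q / q ^ n / (p * u)"] q a z
    by (simp add: V_def W_def K_def b_def f_def A_def field_simps power2_eq_square)
  have W2: "W = W87 b n f (t * z) (u * z) (r * z) q (q / z / p)"
    unfolding W_def by (rule W87_exchange)
  have V2: "V = (- (t / z)) ^ n * K
      * phi43_cleared n (q / q ^ n / (p * t)) (u * z) (r * z) (q / q ^ n * z / p) (r * u) (q / q ^ n * z / t) q"
    using watson_transformation_quotient[OF q b dfd[folded b_def f_def, THEN W87_defined_exchange[THEN iffD1]]
        _ nz', where z = "q / z / p"
        and va = "q / q ^ n / (p * t)" and wa = "q / q ^ n * z / p" and wb = "r * u"
        and wc = "q / q ^ n * z / t" and wd = "r * t" and we = "t * u"
        and y = "t / z"] q a z
    by (simp add: V_def W2 K_def b_def f_def A_def field_simps power2_eq_square)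
  show "R = AW_cleared n q z u p r t"
  proof -
    have "(- p) ^ n * (- (q / q ^ n / (p * u))) ^ n = inverse (u ^ n) * (q / q ^ n) ^ n"
    proof -
      have "(- p) * (- (q / q ^ n / (p * u))) = inverse u * (q / q ^ n)"
        using a q by (simp add: field_simps)
      then show ?thesis by (metis power_inverse power_mult_distrib)
    qed
    then have "R = inverse (u ^ n) * ((q / q ^ n) ^ n * (K * K))
        * phi43_cleared n (u / z) (u * z) f (t * u) (r * u) (p * u) q"
      unfolding R V1 by (simp add: mult_ac)
    then show ?thesis
      unfolding K_def power_choose_two_square[OF q(1)] AW_cleared_def f_def A_def
      by (simp add: phi43_cleared_def mult_ac)
  qed
  show "R = rep2_cleared n q z u r p t"
  proof -
    have "(- p) ^ n * (- (t / z)) ^ n = (p * t / z) ^ n"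
      by (simp flip: power_mult_distrib)
    then have "R = (p * t / z) ^ n * (K * K)
        * phi43_cleared n (q / q ^ n / (p * t)) (u * z) (r * z) (q / q ^ n * z / p) (r * u) (q / q ^ n * z / t) q"
      unfolding R V2 by (simp add: mult_ac)
    then show ?thesis
      unfolding rep2_cleared_def K_def by (simp add: phi43_cleared_def mult_ac)
  qed
qed

text \<open>Both factorials of length 2n are split at n: the first halves cancel within the
  prefactor, and the second halves reverse to the factorials (q^(2-2n)/A;q)_n and (qb;q)_n of
  Watson's transformation.\<close>

lemma rep3_eq_cleared:
  defines "A \<equiv> p * r * t * u"
  assumes nz: "qp (A / q) q n * qp (A / z / (q * p)) q (2 * n) \<noteq> 0"
    and dfd: "W87_defined (q / q ^ (2 * n) * p * z / A) n (q / q ^ n * p * r / A) (q / q ^ n * p * t / A)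
      (q / q ^ n * p * u / A) (p * z) q"
  shows "z ^ n * (qp (A / q) q (2 * n) * qp (r / z) q n * qp (t / z) q n * qp (u / z) q n
        * qp (A / z / (q * p)) q n) / (qp (A / q) q n * qp (A / z / (q * p)) q (2 * n))
      * W87 (q / q ^ (2 * n) * p * z / A) n (q / q ^ n * p * r / A) (q / q ^ n * p * t / A)
      (q / q ^ n * p * u / A) (p * z) q (q * z / p) = rep2_cleared n q z p u r t" (is "?R = _")
proof -
  define b where "b = q / q ^ (2 * n) * p * z / A"
  define Y where "Y = A / z / (q * p)"
  define K where "K = q ^ (n choose 2)"
  have A: "A \<noteq> 0" using a by (simp add: A_def)
  have K: "K \<noteq> 0" using q by (simp add: K_def)
  have Y: "Y \<noteq> 0" using q z a A by (simp add: Y_def)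
  have b: "b \<noteq> 0" using q z a A by (simp add: b_def)
  have e: "qp (x / z) q n = (- (x / z)) ^ n * K * qp (q / q ^ n * z / x) q n" if "x \<noteq> 0" for x
    using qp_reverse[of "x / z" q n] q that z by (simp add: K_def)
  have double: "qp v q (2 * n) = qp v q n * qp (v * q ^ n) q n" for v
    using qp_add[of v q n n] by (simp add: mult_2)
  have e1: "qp (A / q * q ^ n) q n = (- (A / q * q ^ n)) ^ n * K * qp (q ^ 2 / q ^ (2 * n) / A) q n"
    using qp_reverse[of "A / q * q ^ n" q n] q A
    by (simp add: K_def power2_eq_square mult_2 mult_2_right power_add mult_ac)
  have e2: "qp (Y * q ^ n) q n = (- (Y * q ^ n)) ^ n * K * qp (q * b) q n"
    using qp_reverse[of "Y * q ^ n" q n] q A Y a z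
    by (simp add: K_def Y_def b_def power2_eq_square mult_2 mult_2_right power_add mult_ac)
  have nz1: "qp (A / q) q n \<noteq> 0" "qp Y q n \<noteq> 0" "qp (q * b) q n \<noteq> 0"
    using nz unfolding Y_def[symmetric] double[of Y] e2 by auto
  define W where "W = W87 b n (q / q ^ n * p * r / A) (q / q ^ n * p * t / A)
      (q / q ^ n * p * u / A) (p * z) q (q * z / p)"
  define V where "V = W * (qp (q / q ^ n * z / r) q n * qp (q / q ^ n * z / t) q n
      * qp (q / q ^ n * z / u) q n * qp (q ^ 2 / q ^ (2 * n) / A) q n) / qp (q * b) q n"
  have V: "V = (- (q / q ^ n / (p * u))) ^ n * K * phi43_cleared n (u * z) (q / q ^ n * p * u / A) (p * z)
      (q / q ^ n * z / r) (q / q ^ n * z / t) (p * u) q"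
    using watson_transformation_quotient[OF q b dfd[folded b_def] _ nz1(3),
        where z = "q * z / p"
        and va = "u * z" and wa = "q / q ^ n * z / r" and wb = "q / q ^ n * z / t"
        and wc = "p * u" and wd = "q / q ^ n * z / u" and we = "q ^ 2 / q ^ (2 * n) / A"
        and y = "q / q ^ n / (p * u)"] q a z
    by (simp add: V_def W_def K_def b_def A_def field_simps power2_eq_square mult_2_right power_add)
  have arg: "q / q ^ n * p * u / A = q / q ^ n / (r * t)"
    using a by (simp add: A_def)
  have pw: "z ^ n * (- (A / q * q ^ n)) ^ n * (- (r / z)) ^ n * (- (t / z)) ^ n * (- (u / z)) ^ n
      / (- (Y * q ^ n)) ^ n * (- (q / q ^ n / (p * u))) ^ n = (r * t / z) ^ n * (q / q ^ n) ^ n"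
  proof -
    have "z * (- (A / q * q ^ n)) * (- (r / z)) * (- (t / z)) * (- (u / z))
      / (- (Y * q ^ n)) * (- (q / q ^ n / (p * u))) = r * t / z * (q / q ^ n)"
      using q a z by (simp add: Y_def A_def field_simps power2_eq_square)
    then show ?thesis by (metis power_divide power_mult_distrib)
  qed
  have "?R = (z ^ n * (- (A / q * q ^ n)) ^ n * (- (r / z)) ^ n * (- (t / z)) ^ n * (- (u / z)) ^ n
      / (- (Y * q ^ n)) ^ n) * (K * K * K) * V"
    unfolding b_def[symmetric] Y_def[symmetric] W_def[symmetric] V_def e[OF a(2)] e[OF a(3)] e[OF a(4)]
      double e1 e2
    using K nz1 by (simp add: mult_ac)
  also have "\<dots> = (z ^ n * (- (A / q * q ^ n)) ^ n * (- (r / z)) ^ n * (- (t / z)) ^ n * (- (u / z)) ^ n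
      / (- (Y * q ^ n)) ^ n * (- (q / q ^ n / (p * u))) ^ n) * (K * K) * (K * K)
      * phi43_cleared n (u * z) (q / q ^ n * p * u / A) (p * z)
      (q / q ^ n * z / r) (q / q ^ n * z / t) (p * u) q"
    unfolding V by (simp only: mult_ac)
  also have "\<dots> = ((q / q ^ n) ^ n * (K * K)) * ((r * t / z) ^ n * (K * K))
      * phi43_cleared n (u * z) (q / q ^ n / (r * t)) (p * z)
      (q / q ^ n * z / r) (q / q ^ n * z / t) (p * u) q"
    unfolding pw arg by (simp only: mult_ac)
  finally show ?thesis
    unfolding K_def power_choose_two_square[OF q(1)] rep2_cleared_def
    by (simp add: phi43_cleared_def mult_ac)
qed

lemma rep2_eq_cleared:
  assumes dfd: "phi43_defined n (p * r) (q / q ^ n * z / t) (q / q ^ n * z / u) q"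
  shows "z ^ n * qp (p * r) q n * qp (t / z) q n * qp (u / z) q n
      * phi43 n (p * z) (r * z) (q / q ^ n / (t * u)) (p * r) (q / q ^ n * z / t) (q / q ^ n * z / u) q q
    = rep2_cleared n q z p r t u" (is "?R = _")
proof -
  define K where "K = q ^ (n choose 2)"
  have e: "qp (x / z) q n = (- (x / z)) ^ n * K * qp (q / q ^ n * z / x) q n" if "x \<noteq> 0" for x
    using qp_reverse[of "x / z" q n] q that z by (simp add: K_def)
  have pw: "z ^ n * (- (t / z)) ^ n * (- (u / z)) ^ n = (t * u / z) ^ n"
    using z by (simp flip: power_mult_distrib)
  have "?R = (z ^ n * (- (t / z)) ^ n * (- (u / z)) ^ n) * (K * K)
      * (qp (p * r) q n * qp (q / q ^ n * z / t) q n * qp (q / q ^ n * z / u) q n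
        * phi43 n (p * z) (r * z) (q / q ^ n / (t * u)) (p * r) (q / q ^ n * z / t) (q / q ^ n * z / u) q q)"
    unfolding e[OF a(3)] e[OF a(4)] by (simp only: mult_ac)
  then show ?thesis
    unfolding phi43_eq_cleared[OF dfd] pw rep2_cleared_def K_def .
qed

text \<open>This is \<open>phi43_cleared_reverse\<close> for the defining series, balanced because
  (pr)(pt)(pu) = A p^2. The prefactor's factorials reverse into the lower factorials of the reversed
  series.\<close>

lemma rep1_eq_cleared:
  defines "A \<equiv> p * r * t * u"
  assumes nz: "qp (A / q) q n \<noteq> 0"
    and dfd: "phi43_defined n (q ^ 2 / q ^ (2 * n) / A) (q / q ^ n * z / p) (q / q ^ n / z / p) q"
  shows "inverse (q ^ (n choose 2)) * inverse ((- p) ^ n)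
      * (qp (A / q) q (2 * n) * qp (p * z) q n * qp (p / z) q n) / qp (A / q) q n
      * phi43 n (q / q ^ n / (p * r)) (q / q ^ n / (p * t)) (q / q ^ n / (p * u))
          (q ^ 2 / q ^ (2 * n) / A) (q / q ^ n * z / p) (q / q ^ n / z / p) q q
    = AW_cleared n q z p r t u" (is "?R = _")
proof -
  define K where "K = q ^ (n choose 2)"
  have A: "A \<noteq> 0" using a by (simp add: A_def)
  have K: "K \<noteq> 0" using q by (simp add: K_def)
  have e1: "qp (A / q * q ^ n) q n = (- (A / q * q ^ n)) ^ n * K * qp (q ^ 2 / q ^ (2 * n) / A) q n"
    using qp_reverse[of "A / q * q ^ n" q n] q A
    by (simp add: K_def power2_eq_square mult_2 mult_2_right power_add mult_ac)
  have e2: "qp (p * z) q n = (- (p * z)) ^ n * K * qp (q / q ^ n / z / p) q n"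
    using qp_reverse[of "p * z" q n] q a z by (simp add: K_def mult_ac)
  have e3: "qp (p / z) q n = (- (p / z)) ^ n * K * qp (q / q ^ n * z / p) q n"
    using qp_reverse[of "p / z" q n] q a z by (simp add: K_def)
  have double: "qp (A / q) q (2 * n) = qp (A / q) q n * qp (A / q * q ^ n) q n"
    using qp_add[of "A / q" q n n] by (simp add: mult_2)
  define S where "S = phi43_cleared n (q / (q ^ n * (p * r))) (q / (q ^ n * (p * t))) (q / (q ^ n * (p * u)))
      (q / (q ^ n * (q ^ n / q * A))) (q / (q ^ n * (p / z))) (q / (q ^ n * (p * z))) q"
  have args: "q ^ 2 / q ^ (2 * n) / A = q / (q ^ n * (q ^ n / q * A))"
    "q / q ^ n * z / p = q / (q ^ n * (p / z))" "q / q ^ n / z / p = q / (q ^ n * (p * z))"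
    "q / q ^ n / (p * r) = q / (q ^ n * (p * r))" "q / q ^ n / (p * t) = q / (q ^ n * (p * t))"
    "q / q ^ n / (p * u) = q / (q ^ n * (p * u))"
    using q A a z by (simp_all add: field_simps power2_eq_square mult_2_right power_add)
  have rev: "K ^ 4 * ((p * r) * (p * t) * (p * u)) ^ n * S
      = phi43_cleared n (q ^ n / q * A) (p / z) (p * z) (p * r) (p * t) (p * u) q"
    unfolding S_def K_def using q a z A
    by (intro phi43_cleared_reverse) (auto simp: A_def field_simps)
  have pw: "inverse ((- p) ^ n) * (- (A / q * q ^ n)) ^ n * (- (p * z)) ^ n * (- (p / z)) ^ n
      * (q / q ^ n) ^ n = inverse (p ^ n) * ((p * r) * (p * t) * (p * u)) ^ n"
  proof -
    have "inverse (- p) * (- (A / q * q ^ n)) * (- (p * z)) * (- (p / z)) * (q / q ^ n)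
        = inverse p * ((p * r) * (p * t) * (p * u))"
      using q a z by (simp add: A_def field_simps)
    then show ?thesis by (metis power_inverse power_mult_distrib)
  qed
  have "?R = (inverse ((- p) ^ n) * (- (A / q * q ^ n)) ^ n * (- (p * z)) ^ n * (- (p / z)) ^ n) * (K * K)
      * (qp (q ^ 2 / q ^ (2 * n) / A) q n * qp (q / q ^ n * z / p) q n * qp (q / q ^ n / z / p) q n
        * phi43 n (q / q ^ n / (p * r)) (q / q ^ n / (p * t)) (q / q ^ n / (p * u))
          (q ^ 2 / q ^ (2 * n) / A) (q / q ^ n * z / p) (q / q ^ n / z / p) q q)"
    unfolding double e1 e2 e3 K_def[symmetric] using nz K by (simp add: mult_ac)
  also have "\<dots> = (inverse ((- p) ^ n) * (- (A / q * q ^ n)) ^ n * (- (p * z)) ^ n * (- (p / z)) ^ n)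
      * (K * K) * ((q / q ^ n) ^ n * (K * K)) * S"
    unfolding phi43_eq_cleared[OF dfd] unfolding args S_def K_def power_choose_two_square[OF q(1)] by simp
  also have "\<dots> = (inverse ((- p) ^ n) * (- (A / q * q ^ n)) ^ n * (- (p * z)) ^ n * (- (p / z)) ^ n
      * (q / q ^ n) ^ n) * K ^ 4 * S"
    by (simp only: power4_eq_xxxx mult_ac)
  also have "\<dots> = inverse (p ^ n) * (K ^ 4 * ((p * r) * (p * t) * (p * u)) ^ n * S)"
    unfolding pw by (simp only: mult_ac)
  finally show ?thesis
    unfolding rev AW_cleared_def A_def by (simp add: phi43_cleared_def mult_ac)
qed

end

section \<open>Bookkeeping for the four indices\<close>

lemma four_indices_distinct:
  assumes "{p, r, t, u} = {1, 2, 3, 4 :: nat}"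
  shows "distinct [p, r, t, u]"
proof (rule card_distinct)
  have "set [p, r, t, u] = {1, 2, 3, 4}" using assms by simp
  then show "card (set [p, r, t, u]) = length [p, r, t, u]" by simp
qed

lemma prod_four_indices:
  fixes f :: "nat \<Rightarrow> 'a::comm_monoid_mult"
  assumes "{p, r, t, u} = {1, 2, 3, 4 :: nat}"
  shows "f 1 * f 2 * f 3 * f 4 = f p * f r * f t * f u"
proof -
  have d: "distinct [p, r, t, u]" using assms by (rule four_indices_distinct)
  have "f 1 * f 2 * f 3 * f 4 = (\<Prod>s\<in>{1, 2, 3, 4}. f s)" by (simp add: mult_ac)
  also have "\<dots> = f p * f r * f t * f u"
    unfolding assms[symmetric] using d by (simp add: mult_ac)
  finally show ?thesis .
qed

lemma prod_other_indices:
  fixes f :: "nat \<Rightarrow> 'a::comm_monoid_mult"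
  assumes "{p, r, t, u} = {1, 2, 3, 4 :: nat}"
  shows "(\<Prod>s\<in>{1, 2, 3, 4} - {p}. f s) = f r * f t * f u"
proof -
  have d: "distinct [p, r, t, u]" using assms by (rule four_indices_distinct)
  have "{1, 2, 3, 4} - {p} = {r, t, u}" unfolding assms[symmetric] using d by auto
  then show ?thesis using d by (simp add: mult_ac)
qed

lemma A4_eq: "{p, r, t, u} = {1, 2, 3, 4} \<Longrightarrow> A4 a = a p * a r * a t * a u"
  unfolding A4_def by (rule prod_four_indices)

text \<open>The defining series is symmetric in the three parameters other than its base, so only
  the base index matters.\<close>

lemma AW_cleared_cong_index:
  assumes "{p, r, t, u} = {1, 2, 3, 4}" "{p, r', t', u'} = {1, 2, 3, 4 :: nat}"
  shows "AW_cleared n q z (a p) (a r') (a t') (a u') = AW_cleared n q z (a p) (a r) (a t) (a u)"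
proof -
  have "f r' * f t' * f u' = f r * f t * f u" for f :: "nat \<Rightarrow> complex"
    using assms prod_other_indices[of p _ _ _ f] by metis
  from this[of "\<lambda>s. qp (a p * a s * q ^ k) q (n - k)" for k] this[of a]
  show ?thesis
    unfolding AW_cleared_def phi43_cleared_def by (simp add: mult.assoc)
qed

section \<open>Integer powers as quotients of natural powers, and exponentials as powers of e^(i
  theta)\<close>

lemma power_int_rules:
  fixes q :: complex
  assumes "q \<noteq> 0"
  shows "q powi (int n - 1) = q ^ n / q" "q powi (1 - int n) = q / q ^ n"
    "q powi (2 - 2 * int n) = q ^ 2 / q ^ (2 * n)" "q powi (1 - 2 * int n) = q / q ^ (2 * n)"
    "q powi (2 - int n) = q ^ 2 / q ^ n"
proof -
  have "2 * int n = int (2 * n)" by simp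
  then have *: "q powi (2 * int n) = q ^ (2 * n)" by (metis power_int_of_nat)
  show "q powi (int n - 1) = q ^ n / q" "q powi (1 - int n) = q / q ^ n"
    "q powi (2 - 2 * int n) = q ^ 2 / q ^ (2 * n)" "q powi (1 - 2 * int n) = q / q ^ (2 * n)"
    "q powi (2 - int n) = q ^ 2 / q ^ n"
    using assms by (simp_all add: power_int_diff *)
qed

lemma exp_rules:
  shows "x * exp (- (\<i> * th)) = x / exp (\<i> * th)" "exp (\<i> * of_nat n * th) = exp (\<i> * th) ^ n"
    "exp (- (2 * \<i> * th)) = inverse (exp (\<i> * th) ^ 2)" "exp (2 * \<i> * th) = exp (\<i> * th) ^ 2"
proof -
  show two: "exp (2 * \<i> * th) = exp (\<i> * th) ^ 2"
    using exp_of_nat_mult[of 2 "\<i> * th"] by (simp add: mult.assoc)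
  show "x * exp (- (\<i> * th)) = x / exp (\<i> * th)"
    by (simp add: exp_minus divide_inverse)
  show "exp (\<i> * of_nat n * th) = exp (\<i> * th) ^ n"
    using exp_of_nat_mult[of n "\<i> * th"] by (simp add: mult_ac)
  show "exp (- (2 * \<i> * th)) = inverse (exp (\<i> * th) ^ 2)"
    unfolding exp_minus two ..
qed

section \<open>The representations as instances of the cleared series\<close>

context
  fixes n :: nat and q th :: complex and a :: "nat \<Rightarrow> complex"
  assumes q: "q \<noteq> 0" "norm q \<noteq> 1" and a: "\<forall>s\<in>{1,2,3,4}. a s \<noteq> 0"
begin

lemma a_nonzero:
  assumes "{p, r, t, u} = {1, 2, 3, 4}"
  shows "a p \<noteq> 0" "a r \<noteq> 0" "a t \<noteq> 0" "a u \<noteq> 0"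
  using a unfolding assms[symmetric] by auto

lemma AW_index:
  assumes ix: "{p, r, t, u} = {1, 2, 3, 4}" and dfd: "AW_defined n a q th p r t u"
  shows "AW n a q th p r t u = AW_cleared n q (exp (\<i> * th)) (a p) (a r) (a t) (a u)"
  unfolding AW_def AW_cleared_def power_int_rules[OF q(1)] exp_rules A4_eq[OF ix]
    phi43_eq_cleared[OF dfd[unfolded AW_defined_def], symmetric] by (simp only: mult.assoc)

lemma rep1_index:
  assumes ix: "{p, r, t, u} = {1, 2, 3, 4}" and dfd: "rep1_defined n a q th p r t u"
  shows "rep1 n a q th p r t u = AW_cleared n q (exp (\<i> * th)) (a p) (a r) (a t) (a u)"
  using dfd unfolding rep1_def rep1_defined_def power_int_rules[OF q(1)] exp_rules A4_eq[OF ix]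
  by (intro rep1_eq_cleared[OF q exp_not_eq_zero a_nonzero[OF ix]]) auto

lemma rep2_index:
  assumes ix: "{p, r, t, u} = {1, 2, 3, 4}" and dfd: "rep2_defined n a q th p r t u"
  shows "rep2 n a q th p r t u = rep2_cleared n q (exp (\<i> * th)) (a p) (a r) (a t) (a u)"
  using dfd unfolding rep2_def rep2_defined_def power_int_rules[OF q(1)] exp_rules A4_eq[OF ix]
  by (intro rep2_eq_cleared[OF q exp_not_eq_zero a_nonzero[OF ix]]) auto

lemma rep3_index:
  assumes ix: "{p, r, t, u} = {1, 2, 3, 4}" and dfd: "rep3_defined n a q th p r t u"
  shows "rep3 n a q th p r t u = rep2_cleared n q (exp (\<i> * th)) (a p) (a u) (a r) (a t)"
  using dfd unfolding rep3_def rep3_defined_def power_int_rules[OF q(1)] exp_rules A4_eq[OF ix]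
  by (intro rep3_eq_cleared[OF q exp_not_eq_zero a_nonzero[OF ix]]) auto

lemma rep4_index:
  assumes ix: "{p, r, t, u} = {1, 2, 3, 4}" and dfd: "rep4_defined n a q th p r t u"
  shows "rep4 n a q th p r t u = AW_cleared n q (exp (\<i> * th)) (a u) (a p) (a r) (a t)"
    "rep4 n a q th p r t u = rep2_cleared n q (exp (\<i> * th)) (a u) (a r) (a p) (a t)"
proof -
  have d: "qp (a p * a r * a t * a u * exp (\<i> * th) / a p) q n \<noteq> 0"
    "W87_defined (a p * a r * a t * a u * exp (\<i> * th) / (q * a p)) n (a r * exp (\<i> * th))
      (a t * exp (\<i> * th)) (a u * exp (\<i> * th)) (q ^ n / q * (a p * a r * a t * a u)) q"
    using dfd unfolding rep4_defined_def power_int_rules[OF q(1)] exp_rules A4_eq[OF ix] by auto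
  show "rep4 n a q th p r t u = AW_cleared n q (exp (\<i> * th)) (a u) (a p) (a r) (a t)"
    "rep4 n a q th p r t u = rep2_cleared n q (exp (\<i> * th)) (a u) (a r) (a p) (a t)"
    unfolding rep4_def power_int_rules[OF q(1)] exp_rules A4_eq[OF ix]
    using rep4_eq_cleared[OF q exp_not_eq_zero a_nonzero[OF ix] d] by simp_all
qed

lemma rep5_index:
  assumes ix: "{p, r, t, u} = {1, 2, 3, 4}" and dfd: "rep5_defined n a q th p r t u"
  shows "rep5 n a q th p r t u = AW_cleared n q (exp (\<i> * th)) (a p) (a r) (a t) (a u)"
    "rep5 n a q th p r t u = rep2_cleared n q (exp (\<i> * th)) (a p) (a u) (a r) (a t)"
proof -
  have d: "qp (a r / a p) q n \<noteq> 0"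
    "W87_defined (inverse (q ^ n) * a p / a r) n (q / q ^ n / (a r * a t)) (q / q ^ n / (a r * a u))
      (a p * exp (\<i> * th)) (a p / exp (\<i> * th)) q"
    using dfd unfolding rep5_defined_def power_int_rules[OF q(1)] exp_rules by auto
  show "rep5 n a q th p r t u = AW_cleared n q (exp (\<i> * th)) (a p) (a r) (a t) (a u)"
    "rep5 n a q th p r t u = rep2_cleared n q (exp (\<i> * th)) (a p) (a u) (a r) (a t)"
    unfolding rep5_def power_int_rules[OF q(1)] exp_rules
    using rep5_eq_cleared[OF q exp_not_eq_zero a_nonzero[OF ix] d] by simp_all
qed

text \<open>\<open>rep6\<close> lists the indices in the fixed order 1 to 4; its symmetry makes any
  arrangement, and so any kept pair, available.\<close>

lemma rep6_index:
  assumes ix: "{p, r, t, u} = {1, 2, 3, 4}" and dfd: "rep6_defined n a q th"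
  shows "rep6 n a q th = rep2_cleared n q (exp (\<i> * th)) (a t) (a u) (a p) (a r)"
proof -
  define z where "z = exp (\<i> * th)"
  define b where "b = inverse (q ^ n) * z ^ 2"
  \<comment> \<open>Nested to the right, so that it matches the products in \<open>W87_def\<close>
    after rewriting with associativity.\<close>
  have perm: "f (a 1) * (f (a 2) * (f (a 3) * f (a 4))) = f (a p) * (f (a r) * (f (a t) * f (a u)))"
    for f :: "complex \<Rightarrow> complex"
    using prod_four_indices[OF ix, of "\<lambda>s. f (a s)"] by (simp add: mult.assoc)
  have W: "W87 b n (a 1 * z) (a 2 * z) (a 3 * z) (a 4 * z) q y
      = W87 b n (a p * z) (a r * z) (a t * z) (a u * z) q y" for y
  proof -
    have "qp (a 1 * z) q k * (qp (a 2 * z) q k * (qp (a 3 * z) q k * qp (a 4 * z) q k))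
        = qp (a p * z) q k * (qp (a r * z) q k * (qp (a t * z) q k * qp (a u * z) q k))" for k
      by (rule perm)
    moreover have "qp (q * b / (a 1 * z)) q k * (qp (q * b / (a 2 * z)) q k * (qp (q * b / (a 3 * z)) q k * qp (q * b / (a 4 * z)) q k))
        = qp (q * b / (a p * z)) q k * (qp (q * b / (a r * z)) q k * (qp (q * b / (a t * z)) q k * qp (q * b / (a u * z)) q k))" for k
      by (rule perm)
    ultimately show ?thesis unfolding W87_def by (simp only: mult.assoc)
  qed
  have nz: "qp (inverse (z ^ 2)) q n \<noteq> 0"
    and D: "W87_defined b n (a 1 * z) (a 2 * z) (a 3 * z) (a 4 * z) q"
    using dfd unfolding rep6_defined_def exp_rules z_def b_def by auto
  have D': "W87_defined b n (a p * z) (a r * z) (a t * z) (a u * z) q"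
  proof -
    have "qp (q * b / (a 1 * z)) q k * (qp (q * b / (a 2 * z)) q k * (qp (q * b / (a 3 * z)) q k * qp (q * b / (a 4 * z)) q k))
        = qp (q * b / (a p * z)) q k * (qp (q * b / (a r * z)) q k * (qp (q * b / (a t * z)) q k * qp (q * b / (a u * z)) q k))" for k
      by (rule perm)
    then show ?thesis
      using D a_nonzero[OF ix] unfolding W87_defined_def by (simp only: mult.assoc) (simp add: z_def)
  qed
  have P: "qp (a 1 / z) q n * qp (a 2 / z) q n * qp (a 3 / z) q n * qp (a 4 / z) q n
      = qp (a p / z) q n * qp (a r / z) q n * qp (a t / z) q n * qp (a u / z) q n"
    by (rule prod_four_indices[OF ix])
  show ?thesis
    unfolding rep6_def power_int_rules[OF q(1)] exp_rules z_def[symmetric] b_def[symmetric] W P A4_eq[OF ix]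
    using rep6_eq_cleared[OF q _ a_nonzero[OF ix] nz D'[unfolded b_def]] by (simp add: z_def b_def)
qed

end

section \<open>Assembly of all representations around \<open>rep6\<close>\<close>

theorem theorem3p1:
  fixes n :: nat and q th :: complex and a :: "nat \<Rightarrow> complex"
    and p r t u p' r' t' u' :: nat
  assumes "q \<noteq> 0" and "norm q \<noteq> 1"
    and "\<forall>s\<in>{1,2,3,4}. a s \<noteq> 0"
    and "{p, r, t, u} = {1, 2, 3, 4}" and "{p', r', t', u'} = {1, 2, 3, 4}"
    and "AW_defined n a q th p r t u" and "AW_defined n a q th p' r' t' u'"
    and "rep1_defined n a q th p r t u" and "rep2_defined n a q th p r t u"
    and "rep3_defined n a q th p r t u" and "rep4_defined n a q th p r t u"
    and "rep5_defined n a q th p r t u" and "rep6_defined n a q th"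
  shows "AW n a q th p' r' t' u' = AW n a q th p r t u
    \<and> rep1 n a q th p r t u = AW n a q th p r t u
    \<and> rep2 n a q th p r t u = AW n a q th p r t u
    \<and> rep3 n a q th p r t u = AW n a q th p r t u
    \<and> rep4 n a q th p r t u = AW n a q th p r t u
    \<and> rep5 n a q th p r t u = AW n a q th p r t u
    \<and> rep6 n a q th = AW n a q th p r t u"
proof -
  note hyps = assms(1-3)
  define z where "z = exp (\<i> * th)"
  let ?AW = "\<lambda>p r t u. AW_cleared n q z (a p) (a r) (a t) (a u)"
  let ?R2 = "\<lambda>p r t u. rep2_cleared n q z (a p) (a r) (a t) (a u)"
  have R6: "rep6 n a q th = ?R2 i j k l" if "{k, l, i, j} = {1, 2, 3, 4}" for i j k l
    using rep6_index[OF hyps that assms(13)] by (simp add: z_def)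
  have AW: "AW n a q th p r t u = ?AW p r t u"
    using AW_index[OF hyps assms(4,6)] by (simp add: z_def)
  have AW': "AW n a q th p' r' t' u' = ?AW p' r' t' u'"
    using AW_index[OF hyps assms(5,7)] by (simp add: z_def)
  have R5: "rep5 n a q th p r t u = ?AW p r t u" "rep5 n a q th p r t u = ?R2 p u r t"
    using rep5_index[OF hyps assms(4,12)] by (simp_all add: z_def)
  have R4: "?AW l i j k = ?R2 l j i k" "rep4 n a q th i j k l = ?R2 l j i k"
    if "{i, j, k, l} = {1, 2, 3, 4}" "rep4_defined n a q th i j k l" for i j k l
    using rep4_index[OF hyps that] by (simp_all add: z_def)
  \<comment> \<open>The fifth representation, read with both pairings, ties \<open>rep6\<close> to
    the defining series based at p.\<close>
  have base: "rep6 n a q th = ?AW p r t u"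
    using R6[of r t p u] R5 assms(4) by (simp add: insert_commute)
  \<comment> \<open>The fourth representation does the same for the series based at its last
    index.\<close>
  have AWl: "?AW l i j k = rep6 n a q th"
    if "{i, j, k, l} = {1, 2, 3, 4}" "rep4_defined n a q th i j k l" for i j k l
    using R4(1)[OF that] R6[of i k l j] that(1) by (simp add: insert_commute)
  have ix: "{p, t, u, r} = {1, 2, 3, 4}" "{p, r, u, t} = {1, 2, 3, 4}"
    "{r, p, t, u} = {1, 2, 3, 4}" "{t, p, r, u} = {1, 2, 3, 4}" "{u, p, r, t} = {1, 2, 3, 4}"
    "{t, u, p, r} = {1, 2, 3, 4}"
    using assms(4) by (auto simp: insert_commute)
  \<comment> \<open>Definedness of the fourth representation is symmetric in its last three indices,
    so each of r, t, u can stand last.\<close>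
  have d4: "rep4_defined n a q th p t u r" "rep4_defined n a q th p r u t"
    using assms(11) unfolding rep4_defined_def W87_defined_def by (auto simp: mult_ac)
  have "p' \<in> {p, r, t, u}" using assms(4,5) by auto
  \<comment> \<open>Base p is covered by the fifth representation, the bases r, t, u by the
    fourth.\<close>
  then have "?AW p' r' t' u' = rep6 n a q th"
  proof (elim insertE emptyE)
    assume "p' = p"
    then show ?thesis
      using AW_cleared_cong_index[of p r t u r' t' u'] assms(4,5) base by metis
  next
    assume "p' = r"
    then show ?thesis
      using AW_cleared_cong_index[of r p t u r' t' u'] assms(5) ix AWl[OF ix(1) d4(1)] by metis
  next
    assume "p' = t"
    then show ?thesis
      using AW_cleared_cong_index[of t p r u r' t' u'] assms(5) ix AWl[OF ix(2) d4(2)] by metis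
  next
    assume "p' = u"
    then show ?thesis
      using AW_cleared_cong_index[of u p r t r' t' u'] assms(5) ix AWl[OF assms(4,11)] by metis
  qed
  moreover have "rep1 n a q th p r t u = ?AW p r t u"
    using rep1_index[OF hyps assms(4,8)] by (simp add: z_def)
  moreover have "rep2 n a q th p r t u = rep6 n a q th"
    using rep2_index[OF hyps assms(4,9)] R6[of t u p r] ix by (simp add: z_def)
  moreover have "rep3 n a q th p r t u = rep6 n a q th"
    using rep3_index[OF hyps assms(4,10)] R5 base by (simp add: z_def)
  moreover have "rep4 n a q th p r t u = rep6 n a q th"
    using R4[OF assms(4,11)] AWl[OF assms(4,11)] by simp
  ultimately show ?thesis
    using AW AW' R5(1) base by simp
qed

end
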